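(* Let $G_\alpha$, $\alpha\in I$, be groups and let $\mathcal{F}=\ast_{\alpha\in I}G_\alpha$ be their free product. Let $k,\ell\ge 0$ and $m\ge 1$ be integers, and suppose that $$c_1\cdots c_k\, d_1\cdots d_\ell = h_1^{n_1}\cdots h_m^{n_m}$$ in $\mathcal{F}$, where $c_1,\dots,c_k,d_1,\dots,d_\ell,h_1,\dots,h_m\in\mathcal{F}$ are such that each $c_i$ is a commutator, each $d_i$ is conjugate in $\mathcal{F}$ to an element of some free factor $G_\alpha$, the elements $h_1,\dots,h_m$ are conjugate to each other in $\mathcal{F}$ and are not conjugate to elements of free factors $G_\alpha$ of $\mathcal{F}$, and $n_1,\dots,n_m$ are positive integers. (1) If all the groups $G_\alpha$ are torsion free, then $$\sum_{j=1}^m (n_j-1)\le 2k+\ell-2 .$$ (2) The same inequality $\sum_{j=1}^m (n_j-1)\le 2k+\ell-2$ holds for arbitrary groups $G_\alpha$ (possibly with torsion) whenever the order of every letter of a cyclically reduced word conjugate to $h_1$ is greater than $\sum_{j=1}^m n_j$.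
   Context: A commutator is an element of the form $[x,y]=x^{-1}y^{-1}xy$. Elements of the free product $\mathcal{F}=\ast_{\alpha\in I}G_\alpha$ are regarded as words over the alphabet $\bigcup_{\alpha}G_\alpha$ (the factors intersect pairwise in $\{1\}$), whose elements are called letters. A word is reduced if it is nonempty, none of its letters is $1$, and no two consecutive letters belong to the same free factor. A word $w$ is cyclically reduced if it is nonempty and the word $w^2$ (i.e. $ww$) is reduced. An element of infinite order is regarded as having order greater than any integer. Empty products are equal to $1$. *)

theory Defs
  imports "HOL-Algebra.Multiplicative_Group"
begin

section \<open>Words over a family of groups\<close>

text \<open>
  A letter is a pair \<open>(i, g)\<close> with \<open>i \<in> I\<close> and \<open>g \<in> carrier (G i)\<close>. Tagging the
  elements with their index makes the factors disjoint; the only letters identified in the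
  usual convention (factors meeting in \<open>{1}\<close>) are the identities, and these do not occur in
  reduced words.
\<close>

definition reduced_word ::
    "'i set \<Rightarrow> ('i \<Rightarrow> ('a, 'b) monoid_scheme) \<Rightarrow> ('i \<times> 'a) list \<Rightarrow> bool" where
  "reduced_word I G w \<longleftrightarrow>
     w \<noteq> [] \<and>
     (\<forall>(i, g) \<in> set w. i \<in> I \<and> g \<in> carrier (G i) \<and> g \<noteq> \<one>\<^bsub>G i\<^esub>) \<and>
     successively (\<lambda>x y. fst x \<noteq> fst y) w"

definition cyclically_reduced_word ::
    "'i set \<Rightarrow> ('i \<Rightarrow> ('a, 'b) monoid_scheme) \<Rightarrow> ('i \<times> 'a) list \<Rightarrow> bool" where
  "cyclically_reduced_word I G w \<longleftrightarrow> w \<noteq> [] \<and> reduced_word I G (w @ w)"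


section \<open>The free product\<close>

text \<open>
  The elements of the free product are the reduced words together with the empty word, which is
  the identity. \<open>letter_mult\<close> multiplies a normal form by one letter from the left.
\<close>

fun letter_mult ::
    "('i \<Rightarrow> ('a, 'b) monoid_scheme) \<Rightarrow> 'i \<times> 'a \<Rightarrow> ('i \<times> 'a) list \<Rightarrow> ('i \<times> 'a) list" where
  "letter_mult G (i, g) [] = (if g = \<one>\<^bsub>G i\<^esub> then [] else [(i, g)])"
| "letter_mult G (i, g) ((j, h) # w) =
     (if g = \<one>\<^bsub>G i\<^esub> then (j, h) # w
      else if i \<noteq> j then (i, g) # (j, h) # w
      else if g \<otimes>\<^bsub>G i\<^esub> h = \<one>\<^bsub>G i\<^esub> then w
      else (i, g \<otimes>\<^bsub>G i\<^esub> h) # w)"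

definition free_product ::
    "'i set \<Rightarrow> ('i \<Rightarrow> ('a, 'b) monoid_scheme) \<Rightarrow> ('i \<times> 'a) list monoid" where
  "free_product I G =
     \<lparr>carrier = {w. w = [] \<or> reduced_word I G w},
      mult = (\<lambda>u v. foldr (letter_mult G) u v),
      one = []\<rparr>"

definition factor_embedding ::
    "('i \<Rightarrow> ('a, 'b) monoid_scheme) \<Rightarrow> 'i \<Rightarrow> 'a \<Rightarrow> ('i \<times> 'a) list" where
  "factor_embedding G i g = letter_mult G (i, g) []"


section \<open>Group-theoretic notions\<close>

definition conjugate :: "('a, 'b) monoid_scheme \<Rightarrow> 'a \<Rightarrow> 'a \<Rightarrow> bool" where
  "conjugate F x y \<longleftrightarrow>
     x \<in> carrier F \<and> y \<in> carrier F \<and>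
     (\<exists>g \<in> carrier F. y = inv\<^bsub>F\<^esub> g \<otimes>\<^bsub>F\<^esub> x \<otimes>\<^bsub>F\<^esub> g)"

definition is_commutator :: "('a, 'b) monoid_scheme \<Rightarrow> 'a \<Rightarrow> bool" where
  "is_commutator F c \<longleftrightarrow>
     (\<exists>x \<in> carrier F. \<exists>y \<in> carrier F.
        c = inv\<^bsub>F\<^esub> x \<otimes>\<^bsub>F\<^esub> inv\<^bsub>F\<^esub> y \<otimes>\<^bsub>F\<^esub> x \<otimes>\<^bsub>F\<^esub> y)"

definition conjugate_into_factor ::
    "'i set \<Rightarrow> ('i \<Rightarrow> ('a, 'b) monoid_scheme) \<Rightarrow> ('i \<times> 'a) list \<Rightarrow> bool" where
  "conjugate_into_factor I G x \<longleftrightarrow>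
     (\<exists>i \<in> I. \<exists>g \<in> carrier (G i). conjugate (free_product I G) x (factor_embedding G i g))"

text \<open>\<open>group.ord\<close> is \<open>0\<close> exactly at the elements of infinite order.\<close>

definition order_greater :: "('a, 'b) monoid_scheme \<Rightarrow> 'a \<Rightarrow> nat \<Rightarrow> bool" where
  "order_greater G x N \<longleftrightarrow> group.ord G x = 0 \<or> group.ord G x > N"

definition torsion_free :: "('a, 'b) monoid_scheme \<Rightarrow> bool" where
  "torsion_free G \<longleftrightarrow> (\<forall>x \<in> carrier G. x \<noteq> \<one>\<^bsub>G\<^esub> \<longrightarrow> group.ord G x = 0)"


section \<open>The free product is a group with the expected universal property\<close>

context
  fixes I :: "'i set" and G :: "'i \<Rightarrow> ('a, 'b) monoid_scheme"
  assumes groups: "\<And>i. i \<in> I \<Longrightarrow> group (G i)"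
begin

abbreviation (input) "nf w \<equiv> w = [] \<or> reduced_word I G w"

lemma nf_Cons:
  "nf ((i, g) # w) \<longleftrightarrow> i \<in> I \<and> g \<in> carrier (G i) \<and> g \<noteq> \<one>\<^bsub>G i\<^esub> \<and> nf w \<and>
     (w = [] \<or> fst (hd w) \<noteq> i)"
  by (cases w) (auto simp: reduced_word_def)

lemma letter_mult_nf:
  assumes "i \<in> I" "g \<in> carrier (G i)" "nf w"
  shows "nf (letter_mult G (i, g) w)"
proof -
  interpret group "G i" by (rule groups[OF assms(1)])
  show ?thesis
  proof (cases w)
    case Nil
    then show ?thesis using assms by (auto simp: reduced_word_def)
  next
    case (Cons a v)
    obtain j h where a: "a = (j, h)" by (cases a)
    have H: "j \<in> I" "h \<in> carrier (G j)" "h \<noteq> \<one>\<^bsub>G j\<^esub>" "nf v" "v = [] \<or> fst (hd v) \<noteq> j"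
      using assms(3) nf_Cons unfolding Cons a by blast+
    have "nf ((i, g) # (j, h) # v)" if "i \<noteq> j" "g \<noteq> \<one>\<^bsub>G i\<^esub>"
      using that assms(1,2,3) nf_Cons[of i g "(j, h) # v"] by (simp add: Cons a)
    moreover have "nf ((i, g \<otimes>\<^bsub>G i\<^esub> h) # v)" if "i = j" "g \<otimes>\<^bsub>G i\<^esub> h \<noteq> \<one>\<^bsub>G i\<^esub>"
      using that assms(1,2) H m_closed[of g h] nf_Cons[of i "g \<otimes>\<^bsub>G i\<^esub> h" v] by simp
    ultimately show ?thesis using H assms(3) by (auto simp: Cons a)
  qed
qed

lemma letter_mult_one [simp]: "letter_mult G (i, \<one>\<^bsub>G i\<^esub>) w = w"
  by (cases w) auto

lemma letter_mult_letter_mult: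
  assumes "i \<in> I" "g \<in> carrier (G i)" "h \<in> carrier (G i)" "nf w"
  shows "letter_mult G (i, g) (letter_mult G (i, h) w) = letter_mult G (i, g \<otimes>\<^bsub>G i\<^esub> h) w"
proof -
  interpret group "G i" by (rule groups[OF assms(1)])
  show ?thesis
  proof (cases w)
    case Nil
    then show ?thesis using assms by auto
  next
    case (Cons a v)
    obtain j k where a: "a = (j, k)" by (cases a)
    have H: "k \<in> carrier (G j)" "k \<noteq> \<one>\<^bsub>G j\<^esub>" "v = [] \<or> fst (hd v) \<noteq> j"
      using assms(4) nf_Cons unfolding Cons a by blast+
    show ?thesis
    proof (cases "j = i")
      case False
      then show ?thesis using assms(2,3) by (auto simp: Cons a)
    next
      case True
      note H = H[unfolded True]
      have new: "letter_mult G (i, x) v = (if x = \<one>\<^bsub>G i\<^esub> then v else (i, x) # v)" for x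
        using H(3) by (cases v) auto
      have lm: "letter_mult G (i, x) ((i, k) # v) = letter_mult G (i, x \<otimes>\<^bsub>G i\<^esub> k) v"
        if "x \<in> carrier (G i)" for x
        using that H by (auto simp: new)
      have "letter_mult G (i, g) (letter_mult G (i, y) v) = letter_mult G (i, g \<otimes>\<^bsub>G i\<^esub> y) v"
        if "y \<in> carrier (G i)" for y
        using that assms(2) by (auto simp: new)
      from this[of "h \<otimes>\<^bsub>G i\<^esub> k"] show ?thesis
        using assms(2,3) H by (simp add: Cons a True lm m_assoc del: letter_mult.simps)
    qed
  qed
qed

lemma foldr_letter_mult_nf: "nf u \<Longrightarrow> nf v \<Longrightarrow> nf (foldr (letter_mult G) u v)"
proof (induction u)
  case (Cons a u)
  obtain i g where a: "a = (i, g)" by (cases a)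
  have "i \<in> I" "g \<in> carrier (G i)" "nf u" using Cons.prems(1) nf_Cons unfolding a by blast+
  then show ?case using Cons.IH Cons.prems(2) letter_mult_nf by (simp add: a)
qed auto

lemma foldr_letter_mult:
  assumes "i \<in> I" "g \<in> carrier (G i)" "nf u" "nf v"
  shows "foldr (letter_mult G) (letter_mult G (i, g) u) v =
         letter_mult G (i, g) (foldr (letter_mult G) u v)"
proof (cases u)
  case (Cons a w)
  obtain j h where a: "a = (j, h)" by (cases a)
  have H: "h \<in> carrier (G j)" "nf w" using assms(3) nf_Cons unfolding Cons a by blast+
  have "nf (foldr (letter_mult G) w v)" using H(2) assms(4) by (rule foldr_letter_mult_nf)
  then show ?thesis
    using letter_mult_letter_mult[of i g h "foldr (letter_mult G) w v"] assms H
    by (auto simp: Cons a)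
qed auto

lemma foldr_letter_mult_assoc:
  assumes "nf u" "nf v" "nf w"
  shows "foldr (letter_mult G) (foldr (letter_mult G) u v) w =
         foldr (letter_mult G) u (foldr (letter_mult G) v w)"
  using assms(1)
proof (induction u)
  case (Cons a u)
  obtain i g where a: "a = (i, g)" by (cases a)
  have H: "i \<in> I" "g \<in> carrier (G i)" "nf u" using Cons.prems nf_Cons unfolding a by blast+
  show ?case
    using foldr_letter_mult[OF H(1,2) foldr_letter_mult_nf[OF H(3) assms(2)] assms(3)]
      Cons.IH[OF H(3)] by (simp add: a)
qed simp

lemma foldr_letter_mult_Nil: "nf u \<Longrightarrow> foldr (letter_mult G) u [] = u"
proof (induction u)
  case (Cons a u)
  obtain i g where a: "a = (i, g)" by (cases a)
  have "nf u" "g \<noteq> \<one>\<^bsub>G i\<^esub>" "u = [] \<or> fst (hd u) \<noteq> i"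
    using Cons.prems nf_Cons unfolding a by blast+
  then show ?case using Cons.IH by (cases u) (auto simp: a)
qed simp

lemma free_product_left_inverse:
  "nf u \<Longrightarrow> \<exists>v. nf v \<and> foldr (letter_mult G) v u = []"
proof (induction u)
  case (Cons a u)
  obtain i g where a: "a = (i, g)" by (cases a)
  have H: "i \<in> I" "g \<in> carrier (G i)" "g \<noteq> \<one>\<^bsub>G i\<^esub>" "nf u"
    using Cons.prems nf_Cons unfolding a by blast+
  interpret group "G i" by (rule groups[OF H(1)])
  obtain v where v: "nf v" "foldr (letter_mult G) v u = []" using Cons.IH H(4) by blast
  let ?x = "[(i, inv\<^bsub>G i\<^esub> g)]"
  have x: "nf ?x" using H by (auto simp: reduced_word_def)
  have "foldr (letter_mult G) ?x ((i, g) # u) = u" using H by simp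
  then have "foldr (letter_mult G) (foldr (letter_mult G) v ?x) ((i, g) # u) = []"
    using foldr_letter_mult_assoc[OF v(1) x Cons.prems[unfolded a]] v(2) by simp
  then show ?case using foldr_letter_mult_nf[OF v(1) x] a by blast
qed auto

theorem group_free_product: "group (free_product I G)"
proof (rule groupI)
  fix x y z
  assume "x \<in> carrier (free_product I G)" "y \<in> carrier (free_product I G)"
    "z \<in> carrier (free_product I G)"
  then show "x \<otimes>\<^bsub>free_product I G\<^esub> y \<otimes>\<^bsub>free_product I G\<^esub> z =
      x \<otimes>\<^bsub>free_product I G\<^esub> (y \<otimes>\<^bsub>free_product I G\<^esub> z)"
    using foldr_letter_mult_assoc by (simp add: free_product_def)
qed (use foldr_letter_mult_nf free_product_left_inverse in \<open>auto simp: free_product_def\<close>)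

theorem factor_embedding_hom:
  assumes "i \<in> I"
  shows "factor_embedding G i \<in> hom (G i) (free_product I G)"
    and "inj_on (factor_embedding G i) (carrier (G i))"
proof -
  interpret group "G i" by (rule groups[OF assms])
  show "factor_embedding G i \<in> hom (G i) (free_product I G)"
  proof (rule homI)
    fix g assume "g \<in> carrier (G i)"
    then show "factor_embedding G i g \<in> carrier (free_product I G)"
      using letter_mult_nf[of i g "[]"] assms
      by (auto simp: free_product_def factor_embedding_def)
  next
    fix g h assume gh: "g \<in> carrier (G i)" "h \<in> carrier (G i)"
    show "factor_embedding G i (g \<otimes>\<^bsub>G i\<^esub> h) =
        factor_embedding G i g \<otimes>\<^bsub>free_product I G\<^esub> factor_embedding G i h"
      using gh by (auto simp: free_product_def factor_embedding_def)
  qed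
  show "inj_on (factor_embedding G i) (carrier (G i))"
    by (auto simp: inj_on_def factor_embedding_def split: if_splits)
qed

theorem free_product_universal:
  fixes H :: "('h, 'k) monoid_scheme"
  assumes H: "group H" and f: "\<And>i. i \<in> I \<Longrightarrow> f i \<in> hom (G i) H"
  shows "\<exists>\<phi> \<in> hom (free_product I G) H.
           (\<forall>i \<in> I. \<forall>g \<in> carrier (G i). \<phi> (factor_embedding G i g) = f i g) \<and>
           (\<forall>\<psi> \<in> hom (free_product I G) H.
              (\<forall>i \<in> I. \<forall>g \<in> carrier (G i). \<psi> (factor_embedding G i g) = f i g) \<longrightarrow>
              (\<forall>w \<in> carrier (free_product I G). \<psi> w = \<phi> w))"
proof -
  interpret H: group H by (rule H)
  define \<phi> where "\<phi> = (\<lambda>w. foldr (\<lambda>(i, g) x. f i g \<otimes>\<^bsub>H\<^esub> x) w \<one>\<^bsub>H\<^esub>)"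
  have phi_Nil [simp]: "\<phi> [] = \<one>\<^bsub>H\<^esub>"
    and phi_Cons [simp]: "\<And>i g w. \<phi> ((i, g) # w) = f i g \<otimes>\<^bsub>H\<^esub> \<phi> w"
    by (simp_all add: \<phi>_def)
  have fcl: "f i g \<in> carrier H" if "i \<in> I" "g \<in> carrier (G i)" for i g
    using f that by (auto simp: hom_def)
  have f1: "f i \<one>\<^bsub>G i\<^esub> = \<one>\<^bsub>H\<^esub>" if "i \<in> I" for i
    using hom_one[OF f[OF that] groups[OF that] H] .
  have fm: "f i (g \<otimes>\<^bsub>G i\<^esub> h) = f i g \<otimes>\<^bsub>H\<^esub> f i h"
    if "i \<in> I" "g \<in> carrier (G i)" "h \<in> carrier (G i)" for i g h
    using f[OF that(1)] that by (auto simp: hom_def)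
  have cl: "nf w \<Longrightarrow> \<phi> w \<in> carrier H" for w
  proof (induction w)
    case (Cons a w)
    obtain i g where a: "a = (i, g)" by (cases a)
    have "i \<in> I" "g \<in> carrier (G i)" "nf w" using Cons.prems nf_Cons unfolding a by blast+
    then show ?case using Cons.IH fcl by (simp add: a)
  qed simp
  have lm: "\<phi> (letter_mult G (i, g) w) = f i g \<otimes>\<^bsub>H\<^esub> \<phi> w"
    if "i \<in> I" "g \<in> carrier (G i)" "nf w" for i g w
  proof (cases w)
    case Nil
    then show ?thesis using that f1 fcl by auto
  next
    case (Cons a v)
    obtain j h where a: "a = (j, h)" by (cases a)
    have K: "j \<in> I" "h \<in> carrier (G j)" "nf v" using that(3) nf_Cons unfolding Cons a by blast+
    have "f i g \<otimes>\<^bsub>H\<^esub> (f i h \<otimes>\<^bsub>H\<^esub> \<phi> v) = f i (g \<otimes>\<^bsub>G i\<^esub> h) \<otimes>\<^bsub>H\<^esub> \<phi> v" if "i = j"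
      using that \<open>g \<in> carrier (G i)\<close> K fm[of i g h] fcl[of i g] fcl[of i h] cl[of v]
      by (simp add: H.m_assoc)
    then show ?thesis using that K f1[of i] fcl[of j h] cl[of v] by (auto simp: Cons a)
  qed
  have mult: "nf u \<Longrightarrow> nf v \<Longrightarrow> \<phi> (foldr (letter_mult G) u v) = \<phi> u \<otimes>\<^bsub>H\<^esub> \<phi> v" for u v
  proof (induction u)
    case Nil
    then show ?case using cl[of v] by simp
  next
    case (Cons a u)
    obtain i g where a: "a = (i, g)" by (cases a)
    have K: "i \<in> I" "g \<in> carrier (G i)" "nf u" using Cons.prems nf_Cons unfolding a by blast+
    show ?case
      using Cons.IH[OF K(3) Cons.prems(2)] foldr_letter_mult_nf[OF K(3) Cons.prems(2)]
        lm[OF K(1,2)] cl[OF K(3)] cl[OF Cons.prems(2)] fcl[OF K(1,2)]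
      by (simp add: a H.m_assoc)
  qed
  have hom: "\<phi> \<in> hom (free_product I G) H"
    by (rule homI) (use cl mult in \<open>auto simp: free_product_def\<close>)
  have ext: "\<phi> (factor_embedding G i g) = f i g" if "i \<in> I" "g \<in> carrier (G i)" for i g
    using lm[of i g "[]"] that fcl[of i g] by (simp add: factor_embedding_def)
  have uniq: "\<psi> w = \<phi> w"
    if psi: "\<psi> \<in> hom (free_product I G) H"
      and eq: "\<And>i g. i \<in> I \<Longrightarrow> g \<in> carrier (G i) \<Longrightarrow> \<psi> (factor_embedding G i g) = f i g"
      and w: "nf w" for \<psi> w
    using w
  proof (induction w)
    case Nil
    show ?case using hom_one[OF psi group_free_product H] by (simp add: free_product_def)
  next
    case (Cons a w)
    obtain i g where a: "a = (i, g)" by (cases a)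
    have K: "i \<in> I" "g \<in> carrier (G i)" "g \<noteq> \<one>\<^bsub>G i\<^esub>" "nf w" "w = [] \<or> fst (hd w) \<noteq> i"
      using Cons.prems nf_Cons unfolding a by blast+
    have "a # w = factor_embedding G i g \<otimes>\<^bsub>free_product I G\<^esub> w"
      using K by (cases w) (auto simp: a free_product_def factor_embedding_def)
    moreover have "factor_embedding G i g \<in> carrier (free_product I G)"
      using factor_embedding_hom(1)[OF K(1)] K(2) by (auto simp: hom_def)
    moreover have "w \<in> carrier (free_product I G)" using K(4) by (simp add: free_product_def)
    ultimately have "\<psi> (a # w) = \<psi> (factor_embedding G i g) \<otimes>\<^bsub>H\<^esub> \<psi> w"
      using hom_mult[OF psi] by simp
    then show ?case using eq[OF K(1,2)] Cons.IH[OF K(4)] by (simp add: a)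
  qed
  show ?thesis
    by (rule bexI[OF _ hom]) (use ext uniq in \<open>auto simp: free_product_def\<close>)
qed

end

end

theory Submission
  imports Defs "HOL-Library.Multiset"
begin

text \<open>
  The equation says that a surface of genus \<open>k\<close> with \<open>l + m\<close> boundary circles maps to a wedge
  (joined at an extra star-shaped base region) of classifying spaces of the factors, \<open>l\<close> of the
  circles going into a factor and the others to the powers \<open>w ^ n j\<close> of one cyclically reduced
  word \<open>w\<close> of length \<open>L\<close>. Cut the surface along the preimage of the boundary of the base region:
  every letter occurrence contributes one arc, and only disks contribute positively to the Euler
  characteristic. With \<open>N\<close> the sum of the exponents there are \<open>N L\<close> arcs, so the theorem says that
  there are at most \<open>N (L - 1)\<close> disks.

  Label each letter occurrence by its position \<open>i < L\<close> in \<open>w\<close>. The boundary of a disk over a factor is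
  a cycle of positions that is not constant, because the letters have order greater than \<open>N\<close>; so it
  contains an ascent. The boundary of a disk over the base region contains an ascent of the positions
  shifted by one modulo \<open>L\<close>, because adjacent letters of \<open>w\<close> lie in different factors. An arc is an
  ascent of at most one of the two kinds, and of none if its label is \<open>L - 1\<close>, which happens \<open>N\<close> times.
  (The choice of the two linear orders follows L. Chen's proof of the spectral gap of stable
  commutator length in free products.)
\<close>

section \<open>Cycle decompositions\<close>

text \<open>A permutation of the finite set \<open>P\<close>, each cycle being a list with an
  arbitrary starting point. The empty list meets the cycle condition too and may occur with any
  multiplicity; this is how boundary words without letters are recorded. Outside \<open>P\<close>
  the map \<open>f\<close> is arbitrary.\<close>

definition cycle_dec :: "('p \<Rightarrow> 'p) \<Rightarrow> 'p set \<Rightarrow> 'p list multiset \<Rightarrow> bool" where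
  "cycle_dec f P C \<longleftrightarrow>
     finite P \<and> (\<forall>x\<in>#C. map f x = rotate1 x) \<and> (\<Sum>x\<in>#C. mset x) = mset_set P"

lemma cycle_dec_add:
  assumes "cycle_dec f P (add_mset x R)"
  shows "finite P" "map f x = rotate1 x" "distinct x" "set x \<subseteq> P"
    "\<And>y. y \<in># R \<Longrightarrow> set x \<inter> set y = {}"
proof -
  have fin: "finite P" and sum: "mset x + (\<Sum>x\<in>#R. mset x) = mset_set P"
    using assms by (auto simp: cycle_dec_def)
  \<comment> \<open>Total multiplicity at most one gives distinctness within a list as well as
    disjointness of two lists.\<close>
  have cnt: "count (mset x) a + count (\<Sum>x\<in>#R. mset x) a \<le> 1" for a
    using arg_cong[OF sum, of "\<lambda>M. count M a"] fin by (simp add: count_mset_set')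
  show "finite P" "map f x = rotate1 x" using assms by (auto simp: cycle_dec_def)
  show "distinct x"
  proof (unfold distinct_count_atmost_1, intro allI)
    fix a show "count (mset x) a = (if a \<in> set x then 1 else 0)"
      using cnt[of a] count_greater_zero_iff[of "mset x" a] by (auto simp del: count_greater_zero_iff)
  qed
  show "set x \<subseteq> P"
    using arg_cong[OF sum, of set_mset] fin by auto
  show "set x \<inter> set y = {}" if y: "y \<in># R" for y
  proof (rule ccontr)
    assume "set x \<inter> set y \<noteq> {}"
    then obtain a where a: "a \<in> set x" "a \<in> set y" by blast
    have "a \<in># (\<Sum>x\<in>#R. mset x)" using y a(2) by auto
    then have "count (\<Sum>x\<in>#R. mset x) a \<ge> 1" by (simp add: Suc_leI)
    moreover have "count (mset x) a \<ge> 1" using a(1) by (simp add: Suc_leI del: count_mset)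
    ultimately show False using cnt[of a] by linarith
  qed
qed

lemma cycle_decD:
  assumes "cycle_dec f P C" "x \<in># C"
  shows "map f x = rotate1 x" "distinct x" "set x \<subseteq> P"
  using assms cycle_dec_add[of f P x "C - {#x#}"] by simp_all

text \<open>Rotating a list keeps its multiset, so \<open>f\<close> maps the multiset of all
  entries, which is \<open>P\<close>, to itself; a surjection of a finite set onto itself is
  injective.\<close>

lemma cycle_dec_bij:
  assumes "cycle_dec f P C"
  shows "f ` P = P" "inj_on f P"
proof -
  have fin: "finite P" and sum: "(\<Sum>x\<in>#C. mset x) = mset_set P"
    using assms by (auto simp: cycle_dec_def)
  have gen: "image_mset f (\<Sum>x\<in>#C. mset x) = (\<Sum>x\<in>#C. mset x)"
    if "\<forall>x\<in>#C. map f x = rotate1 x" for C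
    using that
  proof (induction C)
    case (add x C)
    have "mset (map f x) = mset x" using add.prems by (cases x) auto
    then have "image_mset f (mset x) = mset x" by simp
    then show ?case using add by simp
  qed simp
  have "image_mset f (mset_set P) = mset_set P"
    using gen[of C] assms by (simp add: cycle_dec_def sum)
  then show im: "f ` P = P" using fin by (metis finite_set_mset_mset_set set_image_mset)
  show "inj_on f P" using im fin by (simp add: eq_card_imp_inj_on)
qed

lemma cycle_dec_in: "cycle_dec f P C \<Longrightarrow> p \<in> P \<Longrightarrow> f p \<in> P"
  using cycle_dec_bij(1) by blast

lemma cycle_dec_preimage: "cycle_dec f P C \<Longrightarrow> p \<in> P \<Longrightarrow> \<exists>q\<in>P. f q = p"
  using cycle_dec_bij(1)[of f P C] by (metis imageE)

lemma cycle_dec_inj: "cycle_dec f P C \<Longrightarrow> p \<in> P \<Longrightarrow> q \<in> P \<Longrightarrow> f p = f q \<Longrightarrow> p = q"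
  using cycle_dec_bij(2)[of f P C] by (simp add: inj_on_eq_iff)

lemma cycle_dec_rotate:
  assumes "cycle_dec f P (add_mset (u @ v) R)"
  shows "cycle_dec f P (add_mset (v @ u) R)"
proof -
  have "map f (u @ v) = rotate1 (u @ v)" using assms by (rule cycle_dec_add)
  then have "rotate (length u) (map f (u @ v)) = rotate (length u) (rotate1 (u @ v))" by simp
  then have "map f (rotate (length u) (u @ v)) = rotate1 (rotate (length u) (u @ v))"
    by (simp only: rotate_map rotate1_rotate_swap)
  then have "map f (v @ u) = rotate1 (v @ u)" by (simp add: rotate_append)
  then show ?thesis using assms by (auto simp: cycle_dec_def add_ac)
qed

lemma cycle_dec_pick:
  assumes "cycle_dec f P C" "p \<in> P"
  obtains u v R where "C = add_mset (u @ p # v) R"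
proof -
  have "p \<in># (\<Sum>x\<in>#C. mset x)" using assms by (auto simp: cycle_dec_def)
  then obtain x where "x \<in># C" "p \<in> set x" by auto
  then show ?thesis using that by (metis mset_add split_list)
qed

section \<open>Effect of a transposition on the cycles of a permutation\<close>

lemma map_rotate1_split:
  assumes u: "u \<noteq> []" and v: "v \<noteq> []" and d: "distinct (u @ v)"
    and g: "g = f(last u := f (last v), last v := f (last u))"
  shows "map f (u @ v) = rotate1 (u @ v) \<longleftrightarrow> map g u = rotate1 u \<and> map g v = rotate1 v"
proof -
  obtain a u1 where ua: "u = a # u1" using u by (cases u) auto
  obtain b v1 where vb: "v = b # v1" using v by (cases v) auto
  obtain u0 p where up: "u = u0 @ [p]" using u by (cases u rule: rev_cases) auto
  obtain v0 q where vq: "v = v0 @ [q]" using v by (cases v rule: rev_cases) auto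
  have ne: "p \<noteq> q" "p \<notin> set u0" "p \<notin> set v0" "q \<notin> set u0" "q \<notin> set v0"
    using d by (auto simp: up vq)
  have l: "length u0 = length u1" "length v0 = length v1" using ua up vb vq
    by (metis length_Cons length_append_singleton nat.inject)+
  have gu: "map g u = map f u0 @ [f q]" and gv: "map g v = map f v0 @ [f p]"
    using ne by (auto simp: g up vq)
  have fu: "map f u = map f u0 @ [f p]" and fv: "map f v = map f v0 @ [f q]"
    by (simp_all add: up vq)
  have ru: "rotate1 u = u1 @ [a]" and rv: "rotate1 v = v1 @ [b]"
    by (simp_all add: ua vb)
  have ruv: "rotate1 (u @ v) = (u1 @ [b]) @ (v1 @ [a])" by (simp add: ua vb)
  have "map f (u @ v) = rotate1 (u @ v) \<longleftrightarrow>
      (map f u0 @ [f p]) @ (map f v0 @ [f q]) = (u1 @ [b]) @ (v1 @ [a])"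
    by (simp only: ruv map_append[of f u v] fu fv)
  \<comment> \<open>Equal lengths allow a comparison block by block. Between \<open>f\<close> and
    \<open>g\<close> only \<open>p\<close> and \<open>q\<close> exchange their successors, which are
    the heads of \<open>u\<close> and \<open>v\<close>.\<close>
  also have "\<dots> \<longleftrightarrow> map f u0 = u1 \<and> f p = b \<and> map f v0 = v1 \<and> f q = a"
    using l by (subst append_eq_append_conv) auto
  also have "\<dots> \<longleftrightarrow> map g u = rotate1 u \<and> map g v = rotate1 v"
    unfolding gu gv ru rv by auto
  finally show ?thesis .
qed

text \<open>Composition with a transposition cuts a cycle in two or glues two cycles, according to
  whether both points lie on one cycle. The lists are started so that the two points come last in
  \<open>u\<close> and \<open>v\<close>.\<close>

lemma cycle_dec_split_iff:
  assumes u: "u \<noteq> []" and v: "v \<noteq> []"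
    and g: "g = f(last u := f (last v), last v := f (last u))"
  shows "cycle_dec f P (add_mset (u @ v) R) \<longleftrightarrow> cycle_dec g P (add_mset u (add_mset v R))"
    (is "?l \<longleftrightarrow> ?r")
proof
  assume l: ?l
  note d = cycle_dec_add[OF l]
  have "map g y = map f y" if "y \<in># R" for y
    using d(5)[OF that] last_in_set[OF u] last_in_set[OF v] by (auto simp: g)
  then have "(\<forall>y\<in>#R. map g y = rotate1 y) = (\<forall>y\<in>#R. map f y = rotate1 y)" by metis
  then show ?r
    using l map_rotate1_split[OF u v d(3) g] by (simp add: cycle_dec_def add_ac)
next
  assume r: ?r
  note d = cycle_dec_add[OF r]
  have r': "cycle_dec g P (add_mset v (add_mset u R))" using r by (simp add: add_mset_commute)
  note d' = cycle_dec_add[OF r']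
  have "map g y = map f y" if "y \<in># R" for y
    using d(5)[of y] d'(5)[of y] that last_in_set[OF u] last_in_set[OF v] by (auto simp: g)
  then have R: "(\<forall>y\<in>#R. map g y = rotate1 y) = (\<forall>y\<in>#R. map f y = rotate1 y)" by metis
  have "distinct (u @ v)" using d(3) d'(3) d(5)[of v] by simp
  from map_rotate1_split[OF u v this g]
  show ?l using r R by (simp add: cycle_dec_def add_ac)
qed

text \<open>\<open>T\<close> will be triviality in the free product, or no condition at all. If a
  cycle is cut, at most that one \<open>T\<close>-cycle is lost; if two are glued, the result has
  \<open>T\<close> whenever both had it.\<close>

lemma cycle_dec_swap:
  assumes f: "cycle_dec f P C" and ne: "[] \<notin># C" and pq: "p \<in> P" "q \<in> P" "p \<noteq> q"
    and T1: "\<And>u v. set u \<union> set v \<subseteq> P \<Longrightarrow> T (u @ v) \<longleftrightarrow> T (v @ u)"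
    and T2: "\<And>u v. set u \<union> set v \<subseteq> P \<Longrightarrow> T u \<Longrightarrow> T v \<Longrightarrow> T (u @ v)"
  shows "\<exists>C'. cycle_dec (f(p := f q, q := f p)) P C' \<and> [] \<notin># C' \<and>
    size (filter_mset T C) \<le> size (filter_mset T C') + 1"
proof -
  obtain u v R where C: "C = add_mset (u @ p # v) R" using cycle_dec_pick[OF f pq(1)] .
  have uv: "set u \<union> set (p # v) \<subseteq> P" using cycle_dec_add(4)[OF f[unfolded C]] by simp
  have C1: "cycle_dec f P (add_mset (v @ u @ [p]) R)"
    using cycle_dec_rotate[of f P "u @ [p]" v R] f C by simp
  have T: "T (u @ p # v) \<longleftrightarrow> T (v @ u @ [p])"
    using T1[of "u @ [p]" v] uv by simp
  show ?thesis
  proof (cases "q \<in> set (v @ u)")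
    case True
    then obtain a b where ab: "v @ u = a @ q # b" by (meson split_list)
    then have "cycle_dec f P (add_mset ((a @ [q]) @ (b @ [p])) R)"
      using C1 by (metis append.assoc append_Cons append_Nil)
    then have "cycle_dec (f(q := f p, p := f q)) P (add_mset (a @ [q]) (add_mset (b @ [p]) R))"
      by (subst (asm) cycle_dec_split_iff[OF _ _ refl]) simp_all
    moreover have "f(q := f p, p := f q) = f(p := f q, q := f p)" using pq by auto
    ultimately show ?thesis using ne
      by (intro exI[of _ "add_mset (a @ [q]) (add_mset (b @ [p]) R)"]) (auto simp: C)
  next
    case False
    have "q \<in># (\<Sum>x\<in>#add_mset (v @ u @ [p]) R. mset x)" using C1 pq by (simp add: cycle_dec_def)
    then obtain y where "y \<in># R" "q \<in> set y" using False pq by auto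
    then obtain a b R' where R: "R = add_mset (a @ q # b) R'" by (metis mset_add split_list)
    have "cycle_dec f P (add_mset ((a @ [q]) @ b) (add_mset (v @ u @ [p]) R'))"
      using C1 R by (simp add: add_mset_commute)
    then have C2: "cycle_dec f P (add_mset (b @ a @ [q]) (add_mset (v @ u @ [p]) R'))"
      using cycle_dec_rotate[of f P "a @ [q]" b] by blast
    let ?g = "f(p := f q, q := f p)"
    \<comment> \<open>Exchanging twice restores \<open>f\<close>, so the cutting equivalence can be
      read backwards, from \<open>f\<close> to \<open>?g\<close>.\<close>
    have "f = ?g(last (b @ a @ [q]) := ?g (last (v @ u @ [p])),
        last (v @ u @ [p]) := ?g (last (b @ a @ [q])))" using pq by auto
    then have C3: "cycle_dec ?g P (add_mset ((b @ a @ [q]) @ (v @ u @ [p])) R')"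
      using C2 by (subst cycle_dec_split_iff[of "b @ a @ [q]" "v @ u @ [p]" f]) simp_all
    have ab: "set a \<union> set (q # b) \<subseteq> P" using cycle_dec_add(4)[OF C2] by auto
    have T': "T (a @ q # b) \<longleftrightarrow> T (b @ a @ [q])"
      using T1[of "a @ [q]" b] ab by simp
    have "T ((b @ a @ [q]) @ (v @ u @ [p]))" if "T (b @ a @ [q])" "T (v @ u @ [p])"
      using T2[OF _ that] uv ab by auto
    then show ?thesis using C3 ne T T'
      by (intro exI[of _ "add_mset ((b @ a @ [q]) @ (v @ u @ [p])) R'"]) (auto simp: C R)
  qed
qed

lemma cycle_dec_swap_size:
  assumes "cycle_dec f P C" "[] \<notin># C" "p \<in> P" "q \<in> P" "p \<noteq> q"
  shows "\<exists>C'. cycle_dec (f(p := f q, q := f p)) P C' \<and> [] \<notin># C' \<and> size C \<le> size C' + 1"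
  using cycle_dec_swap[OF assms, of "\<lambda>_. True"] by simp

lemma cycle_dec_to_front:
  assumes "cycle_dec f P C" "p \<in> P"
  obtains u v R where "C = add_mset (u @ p # v) R" "cycle_dec f P (add_mset (p # v @ u) R)"
proof -
  obtain u v R where C: "C = add_mset (u @ p # v) R" using cycle_dec_pick[OF assms] .
  have "cycle_dec f P (add_mset ((p # v) @ u) R)"
    by (rule cycle_dec_rotate) (use assms C in simp)
  then show ?thesis using that C by simp
qed

lemma cycle_dec_Cons:
  assumes "cycle_dec f P (add_mset (p # y) R)"
  shows "f p = hd (y @ [p])" "f (last (p # y)) = p" "p \<in> P" "p \<notin> set y" "set y \<subseteq> P"
proof -
  note d = cycle_dec_add[OF assms]
  show "f p = hd (y @ [p])" using d(2) by (cases y) auto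
  show "f (last (p # y)) = p" using d(2)
    by (metis last_map last_snoc list.discI rotate1.simps(2))
  show "p \<in> P" "p \<notin> set y" "set y \<subseteq> P" using d by auto
qed

section \<open>Deleting a point from a permutation\<close>

lemma cycle_dec_remove_fixed:
  assumes "cycle_dec f P (add_mset [p] R)"
  shows "cycle_dec f (P - {p}) R"
proof -
  have "(\<Sum>x\<in>#R. mset x) = mset_set P - {#p#}" using assms by (auto simp: cycle_dec_def) (metis add_mset_remove_trivial)
  moreover have "p \<in> P" using cycle_dec_add(4)[OF assms] by simp
  ultimately show ?thesis using assms by (auto simp: cycle_dec_def mset_set_Diff)
qed

text \<open>The point is first cut off as a fixed point and then dropped; its predecessor
  \<open>last y\<close> inherits its successor.\<close>

lemma cycle_dec_remove:
  assumes "cycle_dec f P (add_mset (p # y) R)" "y \<noteq> []"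
  shows "cycle_dec (f(last y := f p)) (P - {p}) (add_mset y R)"
proof -
  let ?g = "f(p := f (last y), last y := f p)"
  have "cycle_dec ?g P (add_mset [p] (add_mset y R))"
    using assms cycle_dec_split_iff[of "[p]" y ?g f P R] by simp
  then have g: "cycle_dec ?g (P - {p}) (add_mset y R)" by (rule cycle_dec_remove_fixed)
  have "map ?g x = map (f(last y := f p)) x" if "x \<in># add_mset y R" for x
    using cycle_decD(3)[OF g that] by auto
  then show ?thesis using g unfolding cycle_dec_def by metis
qed

lemma cycle_dec_fixed:
  assumes "cycle_dec f P C" "p \<in> P" "f p = p"
  obtains R where "C = add_mset [p] R"
proof -
  obtain u v R where C: "C = add_mset (u @ p # v) R" "cycle_dec f P (add_mset (p # v @ u) R)"
    using cycle_dec_to_front[OF assms(1,2)] .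
  have "v @ u = []" using cycle_dec_Cons(1,4)[OF C(2)] assms(3)
    by (cases "v @ u") (auto simp flip: append_assoc)
  then show ?thesis using that C by simp
qed


section \<open>Counting ascents\<close>

lemma rotate1_fixed_constant:
  assumes "rotate1 l = l" "a \<in> set l"
  shows "a = hd l"
proof -
  obtain i where i: "i < length l" "a = l ! i" using assms(2) by (metis in_set_conv_nth)
  have "l ! i = l ! 0" if "i < length l" for i
    using that
  proof (induction i)
    case (Suc i)
    have "l ! Suc i = rotate1 l ! i" using Suc.prems by (simp add: nth_rotate1)
    then show ?case using Suc assms(1) by simp
  qed simp
  then show ?thesis using i by (metis hd_conv_nth list.size(3) not_less_zero)
qed

text \<open>Along a cycle the values \<open>\<kappa> (f q)\<close> are those of
  \<open>\<kappa>\<close> permuted, so the sums agree; one change without any ascent would make the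
  sum drop strictly.\<close>

lemma cycle_ascent:
  fixes \<kappa> :: "'p \<Rightarrow> nat"
  assumes x: "map f x = rotate1 x" "distinct x" and p: "p \<in> set x" "\<kappa> (f p) \<noteq> \<kappa> p"
  shows "\<exists>q\<in>set x. \<kappa> q < \<kappa> (f q)"
proof (rule ccontr)
  assume "\<not> ?thesis"
  then have le: "\<forall>q\<in>set x. \<kappa> (f q) \<le> \<kappa> q" by auto
  have "sum \<kappa> (set x) = sum_list (map \<kappa> x)" using x(2) by (simp add: sum_list_distinct_conv_sum_set)
  also have "\<dots> = sum_list (map \<kappa> (rotate1 x))" by (cases x) simp_all
  also have "\<dots> = sum_list (map (\<lambda>q. \<kappa> (f q)) x)" by (simp flip: x(1) add: comp_def)
  also have "\<dots> = sum (\<lambda>q. \<kappa> (f q)) (set x)" using x(2) by (simp add: sum_list_distinct_conv_sum_set)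
  also have "\<dots> < sum \<kappa> (set x)"
    by (rule sum_strict_mono_ex1) (use le p in \<open>auto intro!: bexI[of _ p] simp: le_neq_implies_less\<close>)
  finally show False by simp
qed

text \<open>Cycles are disjoint, so witnesses in different cycles are different points.\<close>

lemma cycle_dec_count:
  assumes "cycle_dec f P C" "\<And>x. x \<in># C \<Longrightarrow> T x \<Longrightarrow> \<exists>p\<in>set x. Q p"
  shows "size (filter_mset T C) \<le> card {p \<in> P. Q p}"
proof -
  have "size (filter_mset T C) \<le> size (filter_mset Q (\<Sum>x\<in>#C. mset x))"
    using assms(2)
  proof (induction C)
    case (add x C)
    have IH: "size (filter_mset T C) \<le> size (filter_mset Q (\<Sum>x\<in>#C. mset x))"
      using add by simp
    have "1 \<le> size (filter_mset Q (mset x))" if "T x"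
    proof -
      have "filter_mset Q (mset x) \<noteq> {#}" using add.prems[of x] that by auto
      then show ?thesis unfolding One_nat_def Suc_le_eq nonempty_has_size .
    qed
    then show ?case using IH by auto
  qed simp
  then show ?thesis using assms(1) by (simp add: cycle_dec_def filter_mset_mset_set)
qed

section \<open>Positions of letter occurrences in powers of a word\<close>

lemma image_mset_eq_mset:
  "image_mset f X = mset zs \<Longrightarrow> \<exists>xs. mset xs = X \<and> map f xs = zs"
proof (induction zs arbitrary: X)
  case (Cons z zs)
  then obtain X' x where "X = add_mset x X'" "z = f x" "mset zs = image_mset f X'"
    by (metis msed_map_invR mset.simps(2))
  then show ?case using Cons.IH[of X'] by (metis list.simps(9) mset.simps(2))
qed simp

text \<open>Words are matched one by one and their letters by place. Every point of \<open>P\<close>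
  occurs exactly once in \<open>X\<close>, so this defines a map on \<open>P\<close> refining
  \<open>lab\<close>; it will give each letter occurrence its position in the cyclically reduced
  word.\<close>

lemma relabel_lift:
  assumes sum: "(\<Sum>x\<in>#X. mset x) = mset_set P" "finite P"
    and eq: "image_mset (map lab) X = image_mset (map g) Y"
  obtains \<iota> where "image_mset (map \<iota>) X = Y" "\<And>p. p \<in> P \<Longrightarrow> g (\<iota> p) = lab p"
    "image_mset \<iota> (mset_set P) = (\<Sum>y\<in>#Y. mset y)"
proof -
  obtain ys where ys: "mset ys = Y" using ex_mset by blast
  obtain xs where xs: "mset xs = X" "map (map lab) xs = map (map g) ys"
    using image_mset_eq_mset[of "map lab" X "map (map g) ys"] eq ys by auto
  have P: "mset (concat xs) = mset_set P" using sum(1) xs(1) by (metis mset_concat mset_map sum_mset_sum_list)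
  have setP: "set (concat xs) = P" using arg_cong[OF P, of set_mset] sum(2) by simp
  have dist: "distinct (concat xs)"
    using arg_cong[OF P, of size] setP by (simp add: card_distinct)
  have len: "map length xs = map length ys"
    using arg_cong[OF xs(2), of "map length"] by (simp add: comp_def)
  have lenc: "length (concat xs) = length (concat ys)" by (simp add: length_concat len)
  define \<iota> where "\<iota> = (\<lambda>p. the (map_of (zip (concat xs) (concat ys)) p))"
  have io: "map \<iota> (concat xs) = concat ys"
    by (rule nth_equalityI) (use lenc dist in \<open>auto simp: \<iota>_def map_of_zip_nth\<close>)
  have "map (map \<iota>) xs = ys"
  proof (rule concat_injective)
    show "concat (map (map \<iota>) xs) = concat ys" using io by (simp add: map_concat)
    show "length (map (map \<iota>) xs) = length ys" using len by (metis length_map)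
    show "\<forall>(x, y)\<in>set (zip (map (map \<iota>) xs) ys). length x = length y"
      using len by (auto simp: set_zip) (metis length_map nth_map)
  qed
  then have 1: "image_mset (map \<iota>) X = Y" using xs(1) ys by (metis mset_map)
  have "map lab (concat xs) = map g (map \<iota> (concat xs))"
    using xs(2) io by (simp only: map_concat)
  then have 2: "g (\<iota> p) = lab p" if "p \<in> P" for p using that setP by auto
  have "image_mset \<iota> (mset_set P) = mset (concat ys)" using io P by (metis mset_map)
  also have "\<dots> = (\<Sum>y\<in>#Y. mset y)" using ys by (metis mset_concat mset_map sum_mset_sum_list)
  finally show ?thesis using that 1 2 by blast
qed

lemma concat_replicate_conv_upt:
  "concat (replicate k w) = map (\<lambda>t. w ! (t mod length w)) [0..<k * length w]"
proof (induction k)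
  case (Suc k)
  let ?L = "length w"
  have "[0..<Suc k * ?L] = [0..<?L] @ map (\<lambda>n. n + ?L) [0..<k * ?L]"
    by (subst map_add_upt) (simp add: upt_add_eq_append[of 0] add.commute)
  then have "map (\<lambda>t. w ! (t mod ?L)) [0..<Suc k * ?L] =
      map (\<lambda>t. w ! (t mod ?L)) [0..<?L] @ concat (replicate k w)"
    using Suc by (simp add: comp_def)
  moreover have "map (\<lambda>t. w ! (t mod ?L)) [0..<?L] = w"
    by (rule nth_equalityI) auto
  ultimately show ?case by simp
qed simp

lemma count_mod_upt:
  "i < L \<Longrightarrow> count (mset (map (\<lambda>t. t mod L) [0..<k * L])) i = k"
  for i L k :: nat
proof (induction k)
  case (Suc k)
  have "[0..<Suc k * L] = [0..<L] @ map (\<lambda>n. n + L) [0..<k * L]"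
    by (subst map_add_upt) (simp add: upt_add_eq_append[of 0] add.commute)
  then have "map (\<lambda>t. t mod L) [0..<Suc k * L] = map (\<lambda>t. t mod L) [0..<L] @ map (\<lambda>t. t mod L) [0..<k * L]"
    by (simp add: comp_def)
  moreover have "map (\<lambda>t. t mod L) [0..<L] = [0..<L]"
    by (rule nth_equalityI) auto
  moreover have "count (mset [0..<L]) i = 1"
    using Suc.prems by (simp add: count_mset_set')
  ultimately show ?case using Suc by (simp only: mset_append count_union)
qed simp

text \<open>The rule that the next letter has the next position also holds where the power closes
  up, because \<open>L\<close> divides \<open>k * L\<close>.\<close>

lemma map_Suc_mod_rotate1:
  "map (\<lambda>i. Suc i mod L) (map (\<lambda>t. t mod L) [0..<k * L]) = rotate1 (map (\<lambda>t. t mod L) [0..<k * L])"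
  for L k :: nat
proof (rule nth_equalityI)
  fix i assume "i < length (map (\<lambda>i. Suc i mod L) (map (\<lambda>t. t mod L) [0..<k * L]))"
  then have i: "i < k * L" by simp
  then have "Suc i mod (k * L) < k * L" by (intro mod_less_divisor) linarith
  then show "map (\<lambda>i. Suc i mod L) (map (\<lambda>t. t mod L) [0..<k * L]) ! i =
      rotate1 (map (\<lambda>t. t mod L) [0..<k * L]) ! i"
    using i by (simp add: nth_rotate1 mod_Suc_eq mod_mod_cancel)
qed simp


section \<open>Words and their values\<close>

locale group_family =
  fixes I :: "'i set" and G :: "'i \<Rightarrow> ('a, 'b) monoid_scheme"
  assumes groups: "\<And>i. i \<in> I \<Longrightarrow> group (G i)"
begin

abbreviation F :: "('i \<times> 'a) list monoid" where "F \<equiv> free_product I G"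

abbreviation letters :: "('i \<times> 'a) set" where "letters \<equiv> SIGMA i:I. carrier (G i)"

text \<open>Boundary words are arbitrary words over \<open>letters\<close>, possibly unreduced and
  with identity letters, unlike the elements of \<open>F\<close>; \<open>eval\<close> gives the
  normal form of their product.\<close>

definition eval :: "('i \<times> 'a) list \<Rightarrow> ('i \<times> 'a) list" where
  "eval u = foldr (letter_mult G) u []"

sublocale F: group F
  by (rule group_free_product[OF groups])

lemma one_F [simp]: "\<one>\<^bsub>F\<^esub> = []"
  by (simp add: free_product_def)

lemma l_one_F [simp]: "u \<in> carrier F \<Longrightarrow> [] \<otimes>\<^bsub>F\<^esub> u = u"
  using F.l_one by simp

lemma r_one_F [simp]: "u \<in> carrier F \<Longrightarrow> u \<otimes>\<^bsub>F\<^esub> [] = u"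
  using F.r_one by simp

lemma mult_F: "u \<otimes>\<^bsub>F\<^esub> v = foldr (letter_mult G) u v"
  by (simp add: free_product_def)

lemma carrier_F: "u \<in> carrier F \<longleftrightarrow> u = [] \<or> reduced_word I G u"
  by (simp add: free_product_def)

lemma eval_Nil [simp]: "eval [] = []"
  by (simp add: eval_def)

lemma eval_Cons: "eval (a # u) = letter_mult G a (eval u)"
  by (simp add: eval_def)

lemma eval_closed: "set u \<subseteq> letters \<Longrightarrow> eval u \<in> carrier F"
proof (induction u)
  case (Cons a u)
  then show ?case
    using letter_mult_nf[where I = I and G = G and i = "fst a" and g = "snd a" and w = "eval u", OF groups] by (auto simp: carrier_F eval_Cons)
qed (simp add: carrier_F)

lemma eval_carrier: "u \<in> carrier F \<Longrightarrow> eval u = u"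
  unfolding eval_def carrier_F by (rule foldr_letter_mult_Nil[where I = I and G = G, OF groups])

lemma carrier_F_letters: "u \<in> carrier F \<Longrightarrow> set u \<subseteq> letters"
  by (auto simp: carrier_F reduced_word_def)

lemma eval_append:
  assumes "set u \<subseteq> letters" "set v \<subseteq> letters"
  shows "eval (u @ v) = eval u \<otimes>\<^bsub>F\<^esub> eval v"
  using assms(1)
proof (induction u)
  case Nil
  then show ?case using eval_closed[OF assms(2)] by (simp add: mult_F)
next
  case (Cons a u)
  then show ?case
    using foldr_letter_mult[where I = I and G = G and i = "fst a" and g = "snd a" and u = "eval u" and v = "eval v",
          OF groups]
      eval_closed[of u] eval_closed[OF assms(2)]
    by (auto simp: eval_Cons mult_F carrier_F)
qed

lemma eval_mult: "u \<in> carrier F \<Longrightarrow> v \<in> carrier F \<Longrightarrow> eval (u @ v) = u \<otimes>\<^bsub>F\<^esub> v"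
  by (simp add: eval_append carrier_F_letters eval_carrier)

text \<open>In a group \<open>xy = 1\<close> forces \<open>yx = 1\<close>; hence triviality of a
  cycle does not depend on its starting point.\<close>

lemma eval_trivial_rotate:
  assumes "set u \<union> set v \<subseteq> letters"
  shows "eval (u @ v) = [] \<longleftrightarrow> eval (v @ u) = []"
  using assms F.inv_comm[of "eval u" "eval v"] F.inv_comm[of "eval v" "eval u"]
  by (auto simp: eval_append eval_closed)

lemma eval_trivial_append:
  assumes "set u \<union> set v \<subseteq> letters" "eval u = []"
  shows "eval (u @ v) = eval v"
  using assms F.l_one[of "eval v"] by (auto simp: eval_append eval_closed)

definition word_inv :: "('i \<times> 'a) list \<Rightarrow> ('i \<times> 'a) list" where
  "word_inv u = rev (map (\<lambda>(i, g). (i, inv\<^bsub>G i\<^esub> g)) u)"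

lemma word_inv_letters: "set u \<subseteq> letters \<Longrightarrow> set (word_inv u) \<subseteq> letters"
  using groups by (auto simp: word_inv_def intro: group.inv_closed)

lemma word_inv_Nil [simp]: "word_inv [] = []"
  by (simp add: word_inv_def)

lemma word_inv_Cons: "word_inv ((i, g) # u) = word_inv u @ [(i, inv\<^bsub>G i\<^esub> g)]"
  by (simp add: word_inv_def)

lemma eval_pair:
  assumes "i \<in> I" "g \<in> carrier (G i)"
  shows "eval [(i, inv\<^bsub>G i\<^esub> g), (i, g)] = []"
proof -
  interpret group "G i" by (rule groups[OF assms(1)])
  show ?thesis using assms by (auto simp: eval_def)
qed

lemma eval_word_inv: "set u \<subseteq> letters \<Longrightarrow> eval (word_inv u @ u) = []"
proof (induction u)
  case (Cons a u)
  obtain i g where a: "a = (i, g)" by (cases a)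
  have ig: "i \<in> I" "g \<in> carrier (G i)" using Cons.prems by (auto simp: a)
  interpret group "G i" by (rule groups[OF ig(1)])
  let ?p = "[(i, inv\<^bsub>G i\<^esub> g), (i, g)]"
  have sub: "set ?p \<subseteq> letters" "set u \<subseteq> letters" "set (word_inv u) \<subseteq> letters"
    using ig Cons.prems word_inv_letters[of u] by auto
  have "eval (word_inv (a # u) @ a # u) = eval (word_inv u @ (?p @ u))"
    by (simp add: a word_inv_Cons)
  also have "\<dots> = eval (word_inv u) \<otimes>\<^bsub>F\<^esub> eval (?p @ u)"
    by (rule eval_append) (use sub in auto)
  also have "eval (?p @ u) = eval u"
    by (rule eval_trivial_append) (use sub eval_pair[OF ig] in auto)
  finally show ?case using Cons.IH sub by (simp add: eval_append)
qed simp

lemma eval_word_inv_eq: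
  assumes "set u \<subseteq> letters"
  shows "eval (word_inv u) = inv\<^bsub>F\<^esub> eval u"
  using eval_word_inv[OF assms] assms word_inv_letters[OF assms]
  by (intro F.inv_equality[symmetric]) (auto simp: eval_append eval_closed)


section \<open>Diagrams\<close>

text \<open>
  Combinatorial surfaces: \<open>P\<close> is the set of letter occurrences, the cycles of \<open>s\<close> are the boundary
  words, the cycles of \<open>\<alpha>\<close> bound the pieces lying over the factors, and the cycles of
  \<open>\<gamma> = \<alpha>\<^sup>-\<^sup>1 s\<close> bound the disks lying over the base region. Each \<open>p \<in> P\<close> gives one cutting arc,
  from the end of \<open>p\<close> to the start of \<open>\<alpha> p\<close>. An empty boundary word has no letters and is capped by
  a disk of its own. Nontrivial \<open>\<alpha>\<close>-cycles bound nothing and count \<open>0\<close>, so \<open>euler\<close> bounds the Euler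
  characteristic of every surface cut in this way from above.
\<close>

definition diagram ::
  "'p set \<Rightarrow> ('p \<Rightarrow> 'i \<times> 'a) \<Rightarrow> ('p \<Rightarrow> 'p) \<Rightarrow> ('p \<Rightarrow> 'p) \<Rightarrow> ('p \<Rightarrow> 'p) \<Rightarrow>
    'p list multiset \<Rightarrow> 'p list multiset \<Rightarrow> 'p list multiset \<Rightarrow> bool" where
  "diagram P lab s \<alpha> \<gamma> X A C \<longleftrightarrow>
     cycle_dec s P X \<and> cycle_dec \<alpha> P A \<and> cycle_dec \<gamma> P C \<and> [] \<notin># A \<and> [] \<notin># C \<and>
     (\<forall>p\<in>P. \<alpha> (\<gamma> p) = s p) \<and> (\<forall>p\<in>P. fst (lab (\<alpha> p)) = fst (lab p)) \<and> lab ` P \<subseteq> letters"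

definition disks :: "('p \<Rightarrow> 'i \<times> 'a) \<Rightarrow> 'p list multiset \<Rightarrow> 'p list multiset" where
  "disks lab A = {#x \<in># A. eval (map lab x) = []#}"

definition euler ::
  "'p set \<Rightarrow> ('p \<Rightarrow> 'i \<times> 'a) \<Rightarrow> 'p list multiset \<Rightarrow> 'p list multiset \<Rightarrow> 'p list multiset \<Rightarrow> int"
  where "euler P lab X A C =
     int (count X []) + int (size C) + int (size (disks lab A)) - int (card P)"

text \<open>The invariant carried through all rewriting. Only a lower bound \<open>e\<close> is
  kept, since surgery may also gain disks. Points are natural numbers so that fresh ones are always
  available.\<close>

definition admits :: "int \<Rightarrow> ('i \<times> 'a) list multiset \<Rightarrow> bool" where
  "admits e W \<longleftrightarrow> (\<exists>(P :: nat set) lab s \<alpha> \<gamma> X A C.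
     diagram P lab s \<alpha> \<gamma> X A C \<and> W = image_mset (map lab) X \<and> e \<le> euler P lab X A C)"

lemma admitsI:
  fixes P :: "nat set"
  assumes "diagram P lab s \<alpha> \<gamma> X A C" "W = image_mset (map lab) X" "e \<le> euler P lab X A C"
  shows "admits e W"
  using assms unfolding admits_def by blast

lemma admits_empty: "admits 0 {#}"
  by (rule admitsI[of "{}" "\<lambda>_. undefined" id id id "{#}" "{#}" "{#}"])
    (auto simp: diagram_def cycle_dec_def euler_def disks_def)

lemma admits_mono:
  assumes "admits e W" "e' \<le> e"
  shows "admits e' W"
proof -
  obtain P :: "nat set" and lab s \<alpha> \<gamma> X A C where
    "diagram P lab s \<alpha> \<gamma> X A C" "W = image_mset (map lab) X" "e \<le> euler P lab X A C"
    using assms(1) unfolding admits_def by blast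
  then show ?thesis using assms(2) admitsI order_trans by metis
qed

lemma admits_letters:
  assumes "admits e W" "x \<in># W"
  shows "set x \<subseteq> letters"
proof -
  obtain P :: "nat set" and lab s \<alpha> \<gamma> X A C where
    *: "diagram P lab s \<alpha> \<gamma> X A C" "W = image_mset (map lab) X"
    using assms(1) unfolding admits_def by blast
  then obtain y where y: "y \<in># X" "x = map lab y" using assms(2) by auto
  have "cycle_dec s P X" and lab: "lab ` P \<subseteq> letters" using * by (auto simp only: diagram_def)
  then have "set y \<subseteq> P" using cycle_decD(3) y(1) by blast
  then show ?thesis using lab by (auto simp: y(2))
qed

section \<open>Operations on boundary words: caps, bands and new components\<close>

lemma admits_add_mset_elim:
  assumes "admits e (add_mset u W)"
  obtains P :: "nat set" and lab s \<alpha> \<gamma> x X A C where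
    "diagram P lab s \<alpha> \<gamma> (add_mset x X) A C" "u = map lab x" "W = image_mset (map lab) X"
    "e \<le> euler P lab (add_mset x X) A C"
proof -
  obtain P :: "nat set" and lab s \<alpha> \<gamma> X A C where
    *: "diagram P lab s \<alpha> \<gamma> X A C" "add_mset u W = image_mset (map lab) X" "e \<le> euler P lab X A C"
    using assms unfolding admits_def by blast
  obtain X' x where "X = add_mset x X'" "u = map lab x" "W = image_mset (map lab) X'"
    using *(2) by (metis msed_map_invR)
  then show ?thesis using * that by blast
qed

text \<open>The new component is a disk without letters, counted by
  \<open>count X []\<close>.\<close>

lemma admits_add_empty: "admits e W \<Longrightarrow> admits (e + 1) (add_mset [] W)"
proof -
  assume "admits e W"
  then obtain P :: "nat set" and lab s \<alpha> \<gamma> X A C where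
    *: "diagram P lab s \<alpha> \<gamma> X A C" "W = image_mset (map lab) X" "e \<le> euler P lab X A C"
    unfolding admits_def by blast
  show ?thesis
    by (rule admitsI[of P lab s \<alpha> \<gamma> "add_mset [] X" A C])
      (use * in \<open>auto simp: diagram_def cycle_dec_def euler_def\<close>)
qed

lemma admits_rotate:
  assumes "admits e (add_mset (u @ v) W)"
  shows "admits e (add_mset (v @ u) W)"
proof -
  obtain P :: "nat set" and lab s \<alpha> \<gamma> x X A C where
    *: "diagram P lab s \<alpha> \<gamma> (add_mset x X) A C" "u @ v = map lab x" "W = image_mset (map lab) X"
    "e \<le> euler P lab (add_mset x X) A C"
    using assms by (rule admits_add_mset_elim)
  obtain y z where x: "x = y @ z" "u = map lab y" "v = map lab z"
    using *(2) by (metis map_eq_append_conv)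
  show ?thesis
    by (rule admitsI[of P lab s \<alpha> \<gamma> "add_mset (z @ y) X" A C])
      (use * x in \<open>auto simp: diagram_def euler_def intro: cycle_dec_rotate\<close>)
qed

text \<open>A band is attached between two boundary circles. The last points of both words exchange
  their successors under \<open>s\<close>; the same exchange in \<open>\<gamma>\<close> keeps
  \<open>\<alpha> (\<gamma> p) = s p\<close> with \<open>\<alpha>\<close> unchanged and costs at
  most one disk of \<open>C\<close>. If a word is empty, its cap is lost instead.\<close>

lemma admits_join:
  assumes "admits e (add_mset u (add_mset v W))"
  shows "admits (e - 1) (add_mset (u @ v) W)"
proof -
  obtain P :: "nat set" and lab s \<alpha> \<gamma> x X' A C where
    *: "diagram P lab s \<alpha> \<gamma> (add_mset x X') A C" "u = map lab x"
    "add_mset v W = image_mset (map lab) X'" "e \<le> euler P lab (add_mset x X') A C"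
    using assms by (rule admits_add_mset_elim)
  obtain X y where X': "X' = add_mset y X" "v = map lab y" "W = image_mset (map lab) X"
    using *(3) by (metis msed_map_invR)
  consider "x = []" | "y = []" | "x \<noteq> []" "y \<noteq> []" by blast
  then show ?thesis
  proof cases
    case 1
    show ?thesis
      by (rule admitsI[of P lab s \<alpha> \<gamma> "add_mset y X" A C])
        (use * X' 1 in \<open>auto simp: diagram_def euler_def cycle_dec_def\<close>)
  next
    case 2
    show ?thesis
      by (rule admitsI[of P lab s \<alpha> \<gamma> "add_mset x X" A C])
        (use * X' 2 in \<open>auto simp: diagram_def euler_def cycle_dec_def\<close>)
  next
    case 3
    let ?p = "last x" and ?q = "last y"
    have s: "cycle_dec s P (add_mset x (add_mset y X))"
      and \<gamma>: "cycle_dec \<gamma> P C" "[] \<notin># C"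
      and comp: "\<forall>p\<in>P. \<alpha> (\<gamma> p) = s p"
      using * X' by (auto simp: diagram_def)
    have pq: "?p \<in> P" "?q \<in> P" "?p \<noteq> ?q"
      using cycle_decD(3)[OF s, of x] cycle_decD(3)[OF s, of y] cycle_dec_add(5)[OF s, of y]
        last_in_set[OF 3(1)] last_in_set[OF 3(2)] by auto
    let ?s = "s(?p := s ?q, ?q := s ?p)" and ?\<gamma> = "\<gamma>(?p := \<gamma> ?q, ?q := \<gamma> ?p)"
    have "s = ?s(?p := ?s ?q, ?q := ?s ?p)" using pq by auto
    then have s': "cycle_dec ?s P (add_mset (x @ y) X)"
      using s cycle_dec_split_iff[OF 3, of s ?s] by simp
    obtain C' where C': "cycle_dec ?\<gamma> P C'" "[] \<notin># C'" "size C \<le> size C' + 1"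
      using cycle_dec_swap_size[OF \<gamma> pq] by blast
    show ?thesis
      by (rule admitsI[of P lab ?s \<alpha> ?\<gamma> "add_mset (x @ y) X" A C'])
        (use * X' 3 s' C' pq in \<open>auto simp: diagram_def euler_def\<close>)
  qed
qed

lemma admits_split:
  assumes "admits e (add_mset (u @ v) W)"
  shows "admits (e - 1) (add_mset u (add_mset v W))"
proof -
  obtain P :: "nat set" and lab s \<alpha> \<gamma> z X A C where
    *: "diagram P lab s \<alpha> \<gamma> (add_mset z X) A C" "u @ v = map lab z"
    "W = image_mset (map lab) X" "e \<le> euler P lab (add_mset z X) A C"
    using assms by (rule admits_add_mset_elim)
  obtain x y where z: "z = x @ y" "u = map lab x" "v = map lab y"
    using *(2) by (metis map_eq_append_conv)
  show ?thesis
  proof (cases "x = [] \<or> y = []")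
    case True
    show ?thesis
      by (rule admitsI[of P lab s \<alpha> \<gamma> "add_mset x (add_mset y X)" A C])
        (use * z True in \<open>auto simp: diagram_def euler_def cycle_dec_def\<close>)
  next
    case False
    then have 3: "x \<noteq> []" "y \<noteq> []" by auto
    let ?p = "last x" and ?q = "last y"
    have s: "cycle_dec s P (add_mset (x @ y) X)"
      and \<gamma>: "cycle_dec \<gamma> P C" "[] \<notin># C"
      and comp: "\<forall>p\<in>P. \<alpha> (\<gamma> p) = s p"
      using * z by (auto simp: diagram_def)
    have pq: "?p \<in> P" "?q \<in> P" "?p \<noteq> ?q"
      using cycle_dec_add(3,4)[OF s] last_in_set[OF 3(1)] last_in_set[OF 3(2)] by auto
    let ?s = "s(?p := s ?q, ?q := s ?p)" and ?\<gamma> = "\<gamma>(?p := \<gamma> ?q, ?q := \<gamma> ?p)"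
    have s': "cycle_dec ?s P (add_mset x (add_mset y X))"
      using s cycle_dec_split_iff[OF 3, of ?s s] by simp
    obtain C' where C': "cycle_dec ?\<gamma> P C'" "[] \<notin># C'" "size C \<le> size C' + 1"
      using cycle_dec_swap_size[OF \<gamma> pq] by blast
    show ?thesis
      by (rule admitsI[of P lab ?s \<alpha> ?\<gamma> "add_mset x (add_mset y X)" A C'])
        (use * z 3 s' C' pq in \<open>auto simp: diagram_def euler_def\<close>)
  qed
qed

text \<open>A new component over one factor. On the fresh points \<open>s\<close> and
  \<open>\<alpha>\<close> are the same cyclic shift and \<open>\<gamma>\<close> is the identity, so
  the one-point \<open>\<gamma>\<close>-cycles cancel the new points in \<open>euler\<close>; the
  single new \<open>\<alpha>\<close>-cycle is a disk exactly if \<open>w\<close> is trivial.\<close>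

lemma admits_add_factor_word:
  assumes adm: "admits e W" and w: "w \<noteq> []" "set w \<subseteq> letters" "\<forall>a\<in>set w. fst a = i"
  shows "admits (e + (if eval w = [] then 1 else 0)) (add_mset w W)"
proof -
  obtain P :: "nat set" and lab s \<alpha> \<gamma> X A C where
    *: "diagram P lab s \<alpha> \<gamma> X A C" "W = image_mset (map lab) X" "e \<le> euler P lab X A C"
    using adm unfolding admits_def by blast
  have fin: "finite P" using * by (auto simp: diagram_def cycle_dec_def)
  then obtain n where n: "\<forall>p\<in>P. p < n" using finite_nat_set_iff_bounded by blast
  define r where "r = length w"
  have r: "r > 0" using w by (simp add: r_def)
  define y where "y = [n..<n + r]"
  have y: "set y = {n..<n + r}" "distinct y" "length y = r" "y \<noteq> []"
    using r by (auto simp: y_def)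
  define Q where "Q = P \<union> set y"
  \<comment> \<open>The cyclic shift of the \<open>r\<close> fresh points from \<open>n\<close>
    on.\<close>
  define c where "c = (\<lambda>p. n + Suc (p - n) mod r)"
  define lab' where "lab' = (\<lambda>p. if p < n then lab p else w ! (p - n))"
  define s' where "s' = (\<lambda>p. if p < n then s p else c p)"
  define \<alpha>' where "\<alpha>' = (\<lambda>p. if p < n then \<alpha> p else c p)"
  define \<gamma>' where "\<gamma>' = (\<lambda>p. if p < n then \<gamma> p else p)"
  have c: "map c y = rotate1 y"
    by (rule nth_equalityI) (use r in \<open>auto simp: y_def c_def nth_rotate1\<close>)
  have disj: "P \<inter> set y = {}" using n y by auto
  have mQ: "mset_set Q = mset_set P + mset y"
    using fin disj y(2) by (simp add: Q_def mset_set_Union mset_set_set)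
  have ext: "cycle_dec f' Q (D + Y)"
    if f: "cycle_dec f P D" and f': "\<forall>p\<in>P. f' p = f p" and "\<forall>x\<in>#Y. map f' x = rotate1 x"
      "(\<Sum>x\<in>#Y. mset x) = mset y" for f f' D Y
  proof -
    have "map f' x = rotate1 x" if "x \<in># D" for x
      using cycle_decD[OF f that] f' by (metis map_eq_conv subsetD)
    then show ?thesis using that fin by (auto simp: cycle_dec_def mQ) (simp add: Q_def)
  qed
  have ge: "\<not> p < n" if "p \<in> set y" for p using that y by auto
  have "map s' y = rotate1 y" "map \<alpha>' y = rotate1 y"
    using c ge by (auto simp: s'_def \<alpha>'_def cong: map_cong)
  then have s': "cycle_dec s' Q (add_mset y X)" and \<alpha>': "cycle_dec \<alpha>' Q (add_mset y A)"
    using ext[of s X s' "{#y#}"] ext[of \<alpha> A \<alpha>' "{#y#}"] * n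
    by (auto simp: diagram_def s'_def \<alpha>'_def)
  let ?Y = "image_mset (\<lambda>p. [p]) (mset y)"
  have \<gamma>': "cycle_dec \<gamma>' Q (C + ?Y)"
    using ext[of \<gamma> C \<gamma>' ?Y] * n ge
    by (auto simp: diagram_def \<gamma>'_def image_mset.compositionality comp_def)
  have lab: "map lab' x = map lab x" if "set x \<subseteq> P" for x
    using that n by (auto simp: lab'_def)
  have laby: "map lab' y = w"
    by (rule nth_equalityI) (auto simp: y_def lab'_def r_def)
  have labX: "map lab' x = map lab x" if "x \<in># X" for x
    by (rule lab) (use * that cycle_decD(3)[of s P X] in \<open>auto simp: diagram_def\<close>)
  have labA: "map lab' x = map lab x" if "x \<in># A" for x
    by (rule lab) (use * that cycle_decD(3)[of \<alpha> P A] in \<open>auto simp: diagram_def\<close>)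
  have labw: "lab' p \<in> set w" if "p \<in> set y" for p
    using that by (metis laby image_eqI set_map)
  have cy: "c p \<in> set y" if "p \<in> set y" for p
    using that c by (metis image_eqI set_map set_rotate1)
  have ids: "fst (lab' (\<alpha>' p)) = fst (lab' p)" if "p \<in> Q" for p
  proof (cases "p \<in> P")
    case True
    then have "\<alpha> p \<in> P" "fst (lab (\<alpha> p)) = fst (lab p)"
      using * cycle_dec_in[of \<alpha> P A] by (auto simp: diagram_def)
    then show ?thesis using True n by (auto simp: lab'_def \<alpha>'_def)
  next
    case False
    then have p: "p \<in> set y" using that by (simp add: Q_def)
    then show ?thesis
      using labw[OF p] labw[OF cy[OF p]] w(3) ge[OF p] by (auto simp: \<alpha>'_def)
  qed
  have comp: "\<alpha>' (\<gamma>' p) = s' p" if "p \<in> Q" for p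
    using that * n ge cycle_dec_in[of \<gamma> P C] by (auto simp: Q_def diagram_def \<alpha>'_def s'_def \<gamma>'_def)
  have labQ: "lab' ` Q \<subseteq> letters"
  proof
    fix a assume "a \<in> lab' ` Q"
    then obtain p where p: "p \<in> Q" "a = lab' p" by blast
    show "a \<in> letters"
    proof (cases "p \<in> P")
      case True
      then have "a = lab p" using n p by (simp add: lab'_def)
      then show ?thesis using True * unfolding diagram_def by blast
    next
      case False
      then show ?thesis using p labw[of p] w(2) by (auto simp only: Q_def)
    qed
  qed
  have D: "diagram Q lab' s' \<alpha>' \<gamma>' (add_mset y X) (add_mset y A) (C + ?Y)"
    using s' \<alpha>' \<gamma>' ids comp labQ * y(4) by (auto simp: diagram_def)
  have "card Q = card P + r"
    using fin disj y distinct_card[OF y(2)] by (simp add: Q_def card_Un_disjoint)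
  moreover have "disks lab' A = disks lab A"
    unfolding disks_def by (rule filter_mset_cong) (simp_all only: labA)
  ultimately have "e + (if eval w = [] then 1 else 0) \<le>
      euler Q lab' (add_mset y X) (add_mset y A) (C + ?Y)"
    using *(3) y(3,4) laby by (auto simp: euler_def disks_def)
  moreover have "image_mset (map lab') X = image_mset (map lab) X"
    by (rule image_mset_cong) (rule labX)
  then have "add_mset w W = image_mset (map lab') (add_mset y X)"
    using *(2) laby by simp
  ultimately show ?thesis using D by (intro admitsI)
qed

section \<open>Surgery inside a diagram and removal of letters\<close>

lemma disks_rotate:
  assumes "lab ` P \<subseteq> letters" "set u \<union> set v \<subseteq> P"
  shows "eval (map lab (u @ v)) = [] \<longleftrightarrow> eval (map lab (v @ u)) = []"
  unfolding map_append by (rule eval_trivial_rotate) (use assms in auto)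

lemma disks_append:
  assumes "lab ` P \<subseteq> letters" "set u \<union> set v \<subseteq> P" "eval (map lab u) = []"
  shows "eval (map lab (u @ v)) = eval (map lab v)"
  unfolding map_append by (rule eval_trivial_append) (use assms in auto)

lemma cycle_dec_swap_disks:
  assumes "cycle_dec \<alpha> P A" "[] \<notin># A" "p \<in> P" "q \<in> P" "p \<noteq> q" "lab ` P \<subseteq> letters"
  shows "\<exists>A'. cycle_dec (\<alpha>(p := \<alpha> q, q := \<alpha> p)) P A' \<and> [] \<notin># A' \<and>
    size (disks lab A) \<le> size (disks lab A') + 1"
  unfolding disks_def
  by (rule cycle_dec_swap[OF assms(1-5)])
    (use disks_rotate[OF assms(6)] disks_append[OF assms(6)] in simp_all)

text \<open>
  Composing \<open>\<alpha>\<close> with a transposition so that \<open>\<alpha> p = s p\<close> costs at most one disk among the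
  \<open>\<alpha>\<close>-cycles, but splits a fixed point \<open>p\<close> off its \<open>\<gamma>\<close>-cycle.
\<close>

lemma diagram_align:
  assumes D: "diagram P lab s \<alpha> \<gamma> X A C" and p: "p \<in> P" "fst (lab (s p)) = fst (lab p)"
  shows "\<exists>\<alpha>' \<gamma>' A' C'. diagram P lab s \<alpha>' \<gamma>' X A' C' \<and> \<alpha>' p = s p \<and>
    euler P lab X A C \<le> euler P lab X A' C'"
proof (cases "\<alpha> p = s p")
  case True
  then show ?thesis using D by blast
next
  case False
  note d = D[unfolded diagram_def]
  define q where "q = \<gamma> p"
  have q: "q \<in> P" "\<alpha> q = s p" "q \<noteq> p"
    using d p False cycle_dec_in[of \<gamma> P C] by (auto simp: q_def)
  \<comment> \<open>As \<open>\<alpha> q = s p\<close>, the exchange gives \<open>p\<close> the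
    desired image.\<close>
  let ?\<alpha> = "\<alpha>(p := \<alpha> q, q := \<alpha> p)"
  obtain A' where A': "cycle_dec ?\<alpha> P A'" "[] \<notin># A'" "size (disks lab A) \<le> size (disks lab A') + 1"
    using cycle_dec_swap_disks[of \<alpha> P A p q lab] d p q by metis
  obtain u v R where C: "C = add_mset (u @ p # v) R" "cycle_dec \<gamma> P (add_mset (p # v @ u) R)"
    using cycle_dec_to_front[of \<gamma> P C p] d p by metis
  have ne: "v @ u \<noteq> []"
  proof
    assume "v @ u = []"
    then have "\<gamma> p = p" using cycle_dec_Cons(1)[OF C(2)] by simp
    then show False using q by (simp add: q_def)
  qed
  define r where "r = last (v @ u)"
  have r: "\<gamma> r = p" "r \<in> P" "r \<noteq> p"
    using cycle_dec_Cons[OF C(2)] ne last_in_set[OF ne] by (auto simp: r_def)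
  \<comment> \<open>Here \<open>r\<close> is the \<open>\<gamma>\<close>-predecessor of
    \<open>p\<close>. Now \<open>p\<close> becomes fixed and \<open>r\<close> goes to
    \<open>q\<close>, so the two exchanges cancel in the composite \<open>s\<close>.\<close>
  let ?\<gamma> = "\<gamma>(p := \<gamma> r, r := \<gamma> p)"
  have C': "cycle_dec ?\<gamma> P (add_mset [p] (add_mset (v @ u) R))"
    using cycle_dec_split_iff[of "[p]" "v @ u" ?\<gamma> \<gamma> P R] ne C(2) by (simp add: r_def)
  have inj: "x = y" if "\<gamma> x = \<gamma> y" "x \<in> P" "y \<in> P" for x y
    using cycle_dec_inj[of \<gamma> P C] d that by metis
  have comp: "?\<alpha> (?\<gamma> x) = s x" if x: "x \<in> P" for x
  proof -
    consider "x = p" | "x = r" | "x \<noteq> p" "x \<noteq> r" by blast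
    then show ?thesis
    proof cases
      case 3
      then have "\<gamma> x \<noteq> p" "\<gamma> x \<noteq> q" using inj[of x r] inj[of x p] x p r by (auto simp: q_def)
      then show ?thesis using 3 x d by auto
    qed (use r q d x p in \<open>auto simp: q_def\<close>)
  qed
  have ids: "fst (lab (?\<alpha> x)) = fst (lab x)" if "x \<in> P" for x
  proof -
    have "fst (lab (\<alpha> x)) = fst (lab x)" if "x \<in> P" for x using d that by blast
    from this[of q] this[of p] this[of x] show ?thesis using p q that by auto
  qed
  have "diagram P lab s ?\<alpha> ?\<gamma> X A' (add_mset [p] (add_mset (v @ u) R))"
    using d A' C' comp ids ne by (auto simp only: diagram_def) (auto simp: C)
  moreover have "?\<alpha> p = s p" using q by auto
  moreover have "euler P lab X A C \<le> euler P lab X A' (add_mset [p] (add_mset (v @ u) R))"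
    using A'(3) by (simp add: euler_def C)
  ultimately show ?thesis by blast
qed

text \<open>Dual to \<open>diagram_align\<close>: taking a trivial letter out of its
  \<open>\<alpha>\<close>-cycle does not affect whether that cycle is trivial, so the fixed point
  \<open>p\<close> is an extra disk. It pays for the exchange in \<open>\<gamma>\<close>.\<close>

lemma diagram_isolate:
  assumes D: "diagram P lab s \<alpha> \<gamma> X A C" and p: "p \<in> P" "eval [lab p] = []"
  shows "\<exists>\<alpha>' \<gamma>' A' C'. diagram P lab s \<alpha>' \<gamma>' X A' C' \<and> \<alpha>' p = p \<and>
    euler P lab X A C \<le> euler P lab X A' C'"
proof (cases "\<alpha> p = p")
  case True
  then show ?thesis using D by blast
next
  case False
  note d = D[unfolded diagram_def]
  obtain u v R where A: "A = add_mset (u @ p # v) R" "cycle_dec \<alpha> P (add_mset (p # v @ u) R)"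
    using cycle_dec_to_front[of \<alpha> P A p] d p by metis
  note c = cycle_dec_Cons[OF A(2)]
  have ne: "v @ u \<noteq> []" using c(1) False by auto
  define q where "q = last (v @ u)"
  have q: "\<alpha> q = p" "q \<in> P" "q \<noteq> p"
    using c ne last_in_set[OF ne] by (auto simp: q_def)
  let ?\<alpha> = "\<alpha>(p := \<alpha> q, q := \<alpha> p)"
  have A': "cycle_dec ?\<alpha> P (add_mset [p] (add_mset (v @ u) R))"
    using cycle_dec_split_iff[of "[p]" "v @ u" ?\<alpha> \<alpha> P R] ne A(2) by (simp add: q_def)
  have labP: "lab ` P \<subseteq> letters" using d by blast
  have "eval (map lab (u @ p # v)) = [] \<longleftrightarrow> eval (map lab (p # v @ u)) = []"
    using disks_rotate[OF labP, of u "p # v"] c by simp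
  also have "\<dots> \<longleftrightarrow> eval (map lab (v @ u)) = []"
    using disks_append[OF labP, of "[p]" "v @ u"] c p by simp
  finally have disks: "size (disks lab (add_mset [p] (add_mset (v @ u) R))) = size (disks lab A) + 1"
    using p(2) unfolding disks_def A by auto
  \<comment> \<open>To keep the composite equal to \<open>s\<close>, \<open>\<gamma>\<close> is
    altered where it takes the values \<open>p\<close> and \<open>q\<close>.\<close>
  obtain p' q' where p': "p' \<in> P" "\<gamma> p' = p" and q': "q' \<in> P" "\<gamma> q' = q"
    using cycle_dec_preimage[of \<gamma> P C] d p(1) q(2) by metis
  have pq': "p' \<noteq> q'" using p' q' q by auto
  let ?\<gamma> = "\<gamma>(p' := \<gamma> q', q' := \<gamma> p')"
  obtain C' where C': "cycle_dec ?\<gamma> P C'" "[] \<notin># C'" "size C \<le> size C' + 1"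
    using cycle_dec_swap_size[of \<gamma> P C p' q'] d p' q' pq' by metis
  have inj: "x = y" if "\<gamma> x = \<gamma> y" "x \<in> P" "y \<in> P" for x y
    using cycle_dec_inj[of \<gamma> P C] d that by metis
  have comp: "?\<alpha> (?\<gamma> x) = s x" if x: "x \<in> P" for x
  proof -
    consider "x = p'" | "x = q'" | "x \<noteq> p'" "x \<noteq> q'" by blast
    then show ?thesis
    proof cases
      case 3
      then have "\<gamma> x \<noteq> p" "\<gamma> x \<noteq> q" using inj[of x p'] inj[of x q'] x p' q' by auto
      then show ?thesis using 3 x d by auto
    qed (use p' q' q d x p pq' in auto)
  qed
  have ids: "fst (lab (?\<alpha> x)) = fst (lab x)" if "x \<in> P" for x
  proof -
    have "fst (lab (\<alpha> x)) = fst (lab x)" if "x \<in> P" for x using d that by blast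
    from this[of q] this[of p] this[of x] show ?thesis using p q that by auto
  qed
  have "diagram P lab s ?\<alpha> ?\<gamma> X (add_mset [p] (add_mset (v @ u) R)) C'"
    using d A' C' comp ids ne by (auto simp only: diagram_def) (auto simp: A)
  moreover have "?\<alpha> p = p" using q by auto
  moreover have "euler P lab X A C \<le> euler P lab X (add_mset [p] (add_mset (v @ u) R)) C'"
    using C'(3) disks by (simp add: euler_def)
  ultimately show ?thesis by blast
qed

text \<open>The first letter stays as an identity so that the set of points does not change;
  \<open>admits_delete\<close> removes it afterwards.\<close>

lemma eval_merge:
  assumes "i \<in> I" "g \<in> carrier (G i)" "h \<in> carrier (G i)" "set u \<subseteq> letters"
  shows "eval ((i, \<one>\<^bsub>G i\<^esub>) # (i, g \<otimes>\<^bsub>G i\<^esub> h) # u) = eval ((i, g) # (i, h) # u)"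
  using assms letter_mult_letter_mult[where I = I and G = G and i = i and g = g and h = h
      and w = "eval u", OF groups] letter_mult_one[where I = I and G = G, OF groups] eval_closed[of u]
  by (simp add: eval_Cons carrier_F)

text \<open>After alignment \<open>p\<close> and \<open>q\<close> are consecutive in an
  \<open>\<alpha>\<close>-cycle as well as on the boundary, so moving the label of \<open>p\<close>
  into that of \<open>q\<close> leaves the triviality of every \<open>\<alpha>\<close>-cycle
  unchanged.\<close>

lemma admits_merge:
  assumes adm: "admits e (add_mset ((i, g) # (i, h) # u) W)"
  shows "admits e (add_mset ((i, \<one>\<^bsub>G i\<^esub>) # (i, g \<otimes>\<^bsub>G i\<^esub> h) # u) W)"
proof -
  obtain P :: "nat set" and lab s \<alpha>0 \<gamma>0 x X A0 C0 where
    *: "diagram P lab s \<alpha>0 \<gamma>0 (add_mset x X) A0 C0" "(i, g) # (i, h) # u = map lab x"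
    "W = image_mset (map lab) X" "e \<le> euler P lab (add_mset x X) A0 C0"
    using adm by (rule admits_add_mset_elim)
  obtain p q z where x: "x = p # q # z" "lab p = (i, g)" "lab q = (i, h)" "u = map lab z"
    using *(2) by (auto simp: Cons_eq_map_conv)
  have s0: "cycle_dec s P (add_mset x X)" using *(1) by (simp add: diagram_def)
  have s: "s p = q" "p \<in> P" "q \<in> P" "p \<noteq> q" "p \<notin> set z" "q \<notin> set z"
    using cycle_dec_Cons[of s P p "q # z" X] cycle_dec_add(3)[OF s0] s0 by (auto simp: x)
  obtain \<alpha> \<gamma> A C where D: "diagram P lab s \<alpha> \<gamma> (add_mset x X) A C" "\<alpha> p = q"
    "e \<le> euler P lab (add_mset x X) A C"
    using diagram_align[OF *(1) s(2)] s x *(4) by (metis fst_conv order_trans)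
  note d = D(1)[unfolded diagram_def]
  have labP: "lab ` P \<subseteq> letters" using d by blast
  have mem: "i \<in> I" "g \<in> carrier (G i)" "h \<in> carrier (G i)"
    using labP s(2,3) x by force+
  interpret group "G i" by (rule groups[OF mem(1)])
  define lab' where "lab' = lab(p := (i, \<one>\<^bsub>G i\<^esub>), q := (i, g \<otimes>\<^bsub>G i\<^esub> h))"
  have labP': "lab' ` P \<subseteq> letters" using labP mem by (auto simp: lab'_def)
  have fst': "fst (lab' y) = fst (lab y)" for y by (auto simp: lab'_def x)
  have D': "diagram P lab' s \<alpha> \<gamma> (add_mset x X) A C"
    using d labP' by (auto simp only: diagram_def fst')
  have same: "map lab' y = map lab y" if "p \<notin> set y" "q \<notin> set y" for y
    using that by (auto simp: lab'_def)
  obtain a b R where A: "A = add_mset (a @ p # b) R" "cycle_dec \<alpha> P (add_mset (p # b @ a) R)"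
    using cycle_dec_to_front[of \<alpha> P A p] d s by metis
  note c = cycle_dec_Cons[OF A(2)]
  obtain y where y: "b @ a = q # y"
    using c(1) D(2) s(4) by (cases "b @ a") auto
  have cy: "cycle_dec \<alpha> P (add_mset (p # q # y) R)" using A(2) y by simp
  have pqy: "p \<notin> set y" "q \<notin> set y" "set y \<subseteq> P" using cycle_dec_add(3,4)[OF cy] by auto
  have lab'pq: "lab' p = (i, \<one>\<^bsub>G i\<^esub>)" "lab' q = (i, g \<otimes>\<^bsub>G i\<^esub> h)"
    using s(4) by (simp_all add: lab'_def)
  have "set (map lab y) \<subseteq> letters" using labP pqy(3) by auto
  then have ev: "eval (map lab' (p # q # y)) = eval (map lab (p # q # y))"
    unfolding list.map same[OF pqy(1,2)] lab'pq x(2,3) by (rule eval_merge[OF mem])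
  have "eval (map l (a @ p # b)) = [] \<longleftrightarrow> eval (map l (p # q # y)) = []"
    if "l ` P \<subseteq> letters" for l
  proof -
    have "set a \<union> set (p # b) \<subseteq> P" using c by auto
    from disks_rotate[OF that this] show ?thesis using y by simp
  qed
  then have 1: "eval (map lab' (a @ p # b)) = [] \<longleftrightarrow> eval (map lab (a @ p # b)) = []"
    using labP labP' ev by simp
  have labR: "map lab' w = map lab w" if "w \<in># R" for w
    by (rule same) (use cycle_dec_add(5)[OF cy that] in auto)
  have "filter_mset (\<lambda>x. eval (map lab' x) = []) R = filter_mset (\<lambda>x. eval (map lab x) = []) R"
    by (intro filter_mset_cong) (simp_all only: labR)
  then have disks: "size (disks lab' A) = size (disks lab A)"
    using 1 by (simp add: A disks_def del: map_append)
  have "image_mset (map lab') X = image_mset (map lab) X"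
    by (intro image_mset_cong same) (use cycle_dec_add(5)[OF s0] in \<open>auto simp: x\<close>)
  then have "W = image_mset (map lab') X" using *(3) by simp
  moreover have "map lab' x = (i, \<one>\<^bsub>G i\<^esub>) # (i, g \<otimes>\<^bsub>G i\<^esub> h) # u"
    unfolding x(1,4) list.map same[OF s(5,6)] lab'pq ..
  ultimately show ?thesis using D(3) disks
    by (intro admitsI[OF D']) (auto simp: euler_def)
qed

text \<open>Once the identity letter is alone in its \<open>\<alpha>\<close>-cycle, dropping it
  loses one point and one disk, which balance in \<open>euler\<close>.\<close>

lemma admits_delete:
  assumes adm: "admits e (add_mset ((i, \<one>\<^bsub>G i\<^esub>) # u) W)"
  shows "admits e (add_mset u W)"
proof -
  obtain P :: "nat set" and lab s \<alpha>0 \<gamma>0 x X A0 C0 where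
    *: "diagram P lab s \<alpha>0 \<gamma>0 (add_mset x X) A0 C0" "(i, \<one>\<^bsub>G i\<^esub>) # u = map lab x"
    "W = image_mset (map lab) X" "e \<le> euler P lab (add_mset x X) A0 C0"
    using adm by (rule admits_add_mset_elim)
  obtain p z where x: "x = p # z" "lab p = (i, \<one>\<^bsub>G i\<^esub>)" "u = map lab z"
    using *(2) by (auto simp: Cons_eq_map_conv)
  have s0: "cycle_dec s P (add_mset (p # z) X)" using *(1) by (simp add: diagram_def x)
  note s = cycle_dec_Cons[OF s0]
  have triv: "eval [lab p] = []" by (simp add: x eval_def)
  obtain \<alpha> \<gamma> A C where D: "diagram P lab s \<alpha> \<gamma> (add_mset x X) A C" "\<alpha> p = p"
    "e \<le> euler P lab (add_mset x X) A C"
    using diagram_isolate[OF *(1) s(3) triv] *(4) by (metis order_trans)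
  note d = D(1)[unfolded diagram_def]
  obtain A' where A: "A = add_mset [p] A'" using cycle_dec_fixed[of \<alpha> P A p] d s(3) D(2) by metis
  have A': "cycle_dec \<alpha> (P - {p}) A'" using cycle_dec_remove_fixed[of \<alpha> P p A'] d A by simp
  have disks: "size (disks lab A) = size (disks lab A') + 1" using triv by (simp add: A disks_def)
  have card: "card P = card (P - {p}) + 1"
    using s(3) d by (metis Suc_eq_plus1 card_Suc_Diff1 cycle_dec_def)
  have inj: "x = y" if "\<alpha> x = \<alpha> y" "x \<in> P" "y \<in> P" for x y
    using cycle_dec_inj[of \<alpha> P A] d that by metis
  have injg: "x = y" if "\<gamma> x = \<gamma> y" "x \<in> P" "y \<in> P" for x y
    using cycle_dec_inj[of \<gamma> P C] d that by metis
  have gP: "\<gamma> x \<in> P" if "x \<in> P" for x using cycle_dec_in[of \<gamma> P C] d that by blast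
  have comp: "\<alpha> (\<gamma> x) = s x" if "x \<in> P" for x using d that by blast
  show ?thesis
  proof (cases "z = []")
    \<comment> \<open>The letter was the whole word: its \<open>\<gamma>\<close>-disk
      \<open>[p]\<close> vanishes too and is replaced by the cap of the new empty word.\<close>
    case True
    then have "s p = p" using s(1) by simp
    then have "\<gamma> p = p" using comp[OF s(3)] D(2) inj[of "\<gamma> p" p] gP s(3) by simp
    then obtain C' where C: "C = add_mset [p] C'" using cycle_dec_fixed[of \<gamma> P C p] d s(3) by metis
    have C': "cycle_dec \<gamma> (P - {p}) C'" using cycle_dec_remove_fixed[of \<gamma> P p C'] d C by simp
    have X': "cycle_dec s (P - {p}) (add_mset [] X)"
      using cycle_dec_remove_fixed[of s P p X] s0 True by (simp add: cycle_dec_def)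
    have "diagram (P - {p}) lab s \<alpha> \<gamma> (add_mset [] X) A' C'"
      using d A' C' X' A C unfolding diagram_def by auto
    then show ?thesis
      by (rule admitsI) (use *(3) D(3) True card disks in \<open>auto simp: x C euler_def\<close>)
  next
    case False
    define r where "r = last z"
    have r: "r \<in> P" "r \<noteq> p" "s r = p" using s False last_in_set[OF False] by (auto simp: r_def)
    have X': "cycle_dec (s(r := s p)) (P - {p}) (add_mset z X)"
      using cycle_dec_remove[OF s0 False] by (simp add: r_def)
    \<comment> \<open>As \<open>\<alpha>\<close> fixes \<open>p\<close>, the
      \<open>s\<close>-predecessor of \<open>p\<close> is also its
      \<open>\<gamma>\<close>-predecessor. Both permutations bypass \<open>p\<close> at
      \<open>r\<close>, and the number of \<open>\<gamma>\<close>-cycles stays the same.\<close>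
    have gr: "\<gamma> r = p" using comp[OF r(1)] r D(2) inj[of "\<gamma> r" p] gP s(3) by simp
    obtain a b R where C: "C = add_mset (a @ p # b) R" "cycle_dec \<gamma> P (add_mset (p # b @ a) R)"
      using cycle_dec_to_front[of \<gamma> P C p] d s(3) by metis
    note c = cycle_dec_Cons[OF C(2)]
    have ne: "b @ a \<noteq> []"
    proof
      assume "b @ a = []"
      then have "\<gamma> p = p" using c(1) by simp
      then show False using injg[of p r] gr r s(3) by simp
    qed
    have "last (b @ a) \<in> P" using last_in_set[OF ne] c(5) by blast
    then have "last (b @ a) = r"
      using c(2)[unfolded last_ConsR[OF ne]] injg[of "last (b @ a)" r] gr r(1) by simp
    then have C': "cycle_dec (\<gamma>(r := \<gamma> p)) (P - {p}) (add_mset (b @ a) R)"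
      using cycle_dec_remove[OF C(2) ne] by simp
    have "diagram (P - {p}) lab (s(r := s p)) \<alpha> (\<gamma>(r := \<gamma> p)) (add_mset z X) A' (add_mset (b @ a) R)"
      using d A' C' X' A C ne comp s(3) unfolding diagram_def by auto
    then show ?thesis
      by (rule admitsI) (use *(3) D(3) False card disks in \<open>auto simp: x C euler_def\<close>)
  qed
qed


section \<open>Rewriting words up to equality in the free product\<close>

lemma admits_letter_mult:
  assumes "admits e (add_mset (a # u @ r) W)"
  shows "admits e (add_mset (letter_mult G a u @ r) W)"
proof -
  obtain i g where a: "a = (i, g)" by (cases a)
  show ?thesis
  proof (cases u)
    case Nil
    then show ?thesis using assms admits_delete[of e i r W] by (auto simp: a)
  next
    case (Cons b v)
    obtain j h where b: "b = (j, h)" by (cases b)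
    have *: "admits e (add_mset ((i, g) # (j, h) # v @ r) W)" using assms by (simp add: a b Cons)
    have 1: "admits e (add_mset ((j, h) # v @ r) W)" if "g = \<one>\<^bsub>G i\<^esub>"
      using * admits_delete[of e i] that by simp
    have 2: "admits e (add_mset ((i, g \<otimes>\<^bsub>G i\<^esub> h) # v @ r) W)" if "i = j"
      using * admits_merge[of e i g h] admits_delete[of e i] that by simp
    have 3: "admits e (add_mset (v @ r) W)" if "i = j" "g \<otimes>\<^bsub>G i\<^esub> h = \<one>\<^bsub>G i\<^esub>"
      using 2[OF that(1)] admits_delete[of e i] that by simp
    show ?thesis using * 1 2 3 by (auto simp: a b Cons)
  qed
qed

text \<open>The first letter is rotated behind \<open>r\<close>, the rest of \<open>u\<close> is
  evaluated by induction, and the letter is rotated back and multiplied on.\<close>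

lemma admits_eval: "admits e (add_mset (u @ r) W) \<Longrightarrow> admits e (add_mset (eval u @ r) W)"
proof (induction u arbitrary: r)
  case (Cons a u)
  then have "admits e (add_mset (u @ r @ [a]) W)" using admits_rotate[of e "[a]" "u @ r"] by simp
  then have "admits e (add_mset (eval u @ r @ [a]) W)" by (rule Cons.IH)
  then have "admits e (add_mset (a # eval u @ r) W)" using admits_rotate[of e "eval u @ r" "[a]"] by simp
  then show ?case using admits_letter_mult by (simp add: eval_Cons)
qed simp

text \<open>An inverse pair of letters is a trivial word over one factor: adding it as a separate
  disk gains 1, joining it costs 1.\<close>

lemma admits_insert_inverse:
  "set x \<subseteq> letters \<Longrightarrow> admits e (add_mset u W) \<Longrightarrow> admits e (add_mset (u @ word_inv x @ x) W)"
proof (induction x arbitrary: u)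
  case (Cons a x)
  obtain i g where a: "a = (i, g)" by (cases a)
  have ig: "i \<in> I" "g \<in> carrier (G i)" using Cons.prems by (auto simp: a)
  let ?p = "[(i, inv\<^bsub>G i\<^esub> g), (i, g)]"
  have "admits e (add_mset (u @ word_inv x @ x) W)" using Cons by auto
  then have "admits e (add_mset (x @ u @ word_inv x) W)"
    using admits_rotate[of e "u @ word_inv x" x] by simp
  then have "admits (e + 1) (add_mset ?p (add_mset (x @ u @ word_inv x) W))"
    using admits_add_factor_word[of e _ ?p i] eval_pair[OF ig] ig group.inv_closed[OF groups, of i g]
    by simp
  then have "admits e (add_mset ((x @ u @ word_inv x) @ ?p) W)"
    using admits_join[of "e + 1" "x @ u @ word_inv x" ?p W] by (simp add: add_mset_commute)
  then show ?case
    using admits_rotate[of e x "u @ word_inv x @ ?p"] by (simp add: a word_inv_Cons)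
qed simp

text \<open>Evaluation only leads to normal forms. To reach an arbitrary \<open>v\<close> of the
  same value, \<open>word_inv v @ v\<close> is inserted after \<open>u\<close>, and
  \<open>u @ word_inv v\<close> then evaluates to the empty word.\<close>

lemma admits_cong:
  assumes adm: "admits e (add_mset (u @ r) W)" and v: "set v \<subseteq> letters" and eq: "eval u = eval v"
  shows "admits e (add_mset (v @ r) W)"
proof -
  have "set (u @ r) \<subseteq> letters" using adm by (rule admits_letters) simp
  then have u: "set u \<subseteq> letters" by simp
  have "admits e (add_mset (r @ u) W)" using adm by (rule admits_rotate)
  then have "admits e (add_mset ((r @ u) @ word_inv v @ v) W)" by (rule admits_insert_inverse[OF v])
  then have "admits e (add_mset ((u @ word_inv v) @ (v @ r)) W)"
    using admits_rotate[of e r "u @ word_inv v @ v"] by simp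
  then have "admits e (add_mset (eval (u @ word_inv v) @ (v @ r)) W)" by (rule admits_eval)
  moreover have "eval (u @ word_inv v) = []"
    using u v eq word_inv_letters[OF v] eval_word_inv_eq[OF v] eval_closed[OF v]
    by (simp add: eval_append)
  ultimately show ?thesis by simp
qed

lemma admits_cong':
  assumes "admits e (add_mset u W)" "set v \<subseteq> letters" "eval u = eval v"
  shows "admits e (add_mset v W)"
  using admits_cong[of e u "[]" W v] assms by simp

section \<open>Conjugates, commutators and products as boundary words\<close>

lemma admits_conj:
  assumes adm: "admits e (add_mset x W)" and y: "set y \<subseteq> letters"
  shows "admits e (add_mset (word_inv y @ x @ y) W)"
proof -
  have x: "set x \<subseteq> letters" using admits_letters[OF adm] by auto
  have y': "set (word_inv y) \<subseteq> letters" using y by (rule word_inv_letters)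
  have "eval (y @ word_inv y) = []"
    using y y' eval_word_inv_eq[OF y] eval_closed[OF y] by (simp add: eval_append)
  then have "eval (x @ y @ word_inv y) = eval x"
    using x y y' eval_append[of x "y @ word_inv y"] eval_closed[OF x] by simp
  \<comment> \<open>A boundary word matters only up to rotation, so a conjugate arises from
    inserting a trivial word at the end.\<close>
  then have "admits e (add_mset (x @ y @ word_inv y) W)"
    using admits_cong'[OF adm, of "x @ y @ word_inv y"] x y y' by simp
  then show ?thesis using admits_rotate[of e "x @ y" "word_inv y"] by simp
qed

lemma admits_conjugate:
  assumes adm: "admits e (add_mset x W)" and c: "conjugate F x y"
  shows "admits e (add_mset y W)"
proof -
  obtain g where g: "x \<in> carrier F" "y \<in> carrier F" "g \<in> carrier F"
    "y = inv\<^bsub>F\<^esub> g \<otimes>\<^bsub>F\<^esub> x \<otimes>\<^bsub>F\<^esub> g" using c by (auto simp: conjugate_def)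
  note l = carrier_F_letters[OF g(1)] carrier_F_letters[OF g(2)] carrier_F_letters[OF g(3)]
  have "eval (word_inv g @ x @ g) = inv\<^bsub>F\<^esub> g \<otimes>\<^bsub>F\<^esub> (x \<otimes>\<^bsub>F\<^esub> g)"
    using l word_inv_letters[OF l(3)] eval_word_inv_eq[OF l(3)] g(1,3)
    by (simp add: eval_append eval_carrier)
  also have "\<dots> = eval y" using g by (simp add: F.m_assoc eval_carrier)
  finally show ?thesis
    using admits_cong'[OF admits_conj[OF adm l(3)] l(2)] by simp
qed

lemma conjugate_sym:
  assumes "conjugate F x y"
  shows "conjugate F y x"
proof -
  obtain g where g: "x \<in> carrier F" "y \<in> carrier F" "g \<in> carrier F"
    "y = inv\<^bsub>F\<^esub> g \<otimes>\<^bsub>F\<^esub> x \<otimes>\<^bsub>F\<^esub> g" using assms by (auto simp: conjugate_def)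
  have "inv\<^bsub>F\<^esub> (inv\<^bsub>F\<^esub> g) \<otimes>\<^bsub>F\<^esub> y \<otimes>\<^bsub>F\<^esub> inv\<^bsub>F\<^esub> g = g \<otimes>\<^bsub>F\<^esub> (inv\<^bsub>F\<^esub> g \<otimes>\<^bsub>F\<^esub> x \<otimes>\<^bsub>F\<^esub> g) \<otimes>\<^bsub>F\<^esub> inv\<^bsub>F\<^esub> g"
    using g by simp
  also have "\<dots> = g \<otimes>\<^bsub>F\<^esub> (inv\<^bsub>F\<^esub> g \<otimes>\<^bsub>F\<^esub> (x \<otimes>\<^bsub>F\<^esub> (g \<otimes>\<^bsub>F\<^esub> inv\<^bsub>F\<^esub> g)))"
    using g(1,3) by (simp only: F.m_assoc F.m_closed F.inv_closed)
  also have "\<dots> = x" using g(1,3) F.r_inv[OF g(3)] F.r_one[OF g(1)]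
    by (simp only: F.m_assoc[symmetric] F.inv_closed F.m_closed) (metis F.l_one F.r_inv g(1) one_F)
  finally show ?thesis using g F.inv_closed[OF g(3)] unfolding conjugate_def by metis
qed

text \<open>A commutator bounds a torus with a hole. An empty word gains 1; it becomes
  \<open>word_inv x @ x\<close> and is split, one half is conjugated by \<open>y\<close>, and the
  halves are rejoined, at cost 2. Joining the result to \<open>z\<close> costs 1 more.\<close>

lemma admits_mult_commutator:
  assumes adm: "admits e (add_mset z W)" and z: "z \<in> carrier F" and c: "is_commutator F c"
  shows "admits (e - 2) (add_mset (z \<otimes>\<^bsub>F\<^esub> c) W)"
proof -
  obtain x y where xy: "x \<in> carrier F" "y \<in> carrier F"
    "c = inv\<^bsub>F\<^esub> x \<otimes>\<^bsub>F\<^esub> inv\<^bsub>F\<^esub> y \<otimes>\<^bsub>F\<^esub> x \<otimes>\<^bsub>F\<^esub> y" using c by (auto simp: is_commutator_def)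
  note l = carrier_F_letters[OF z] carrier_F_letters[OF xy(1)] carrier_F_letters[OF xy(2)]
  note l' = word_inv_letters[OF l(2)] word_inv_letters[OF l(3)]
  let ?c = "word_inv x @ word_inv y @ x @ y"
  have "admits (e + 1) (add_mset [] (add_mset z W))" using adm by (rule admits_add_empty)
  then have "admits (e + 1) (add_mset (word_inv x @ x) (add_mset z W))"
    using admits_insert_inverse[OF l(2), of "e + 1" "[]"] by simp
  then have "admits e (add_mset (word_inv x) (add_mset x (add_mset z W)))"
    using admits_split[of "e + 1" "word_inv x" x] by simp
  then have "admits e (add_mset x (add_mset (word_inv x) (add_mset z W)))"
    by (simp add: add_mset_commute)
  then have "admits e (add_mset (word_inv y @ x @ y) (add_mset (word_inv x) (add_mset z W)))"
    using l(3) by (rule admits_conj)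
  then have "admits e (add_mset (word_inv x) (add_mset (word_inv y @ x @ y) (add_mset z W)))"
    by (simp add: add_mset_commute)
  then have "admits (e - 1) (add_mset ?c (add_mset z W))" by (rule admits_join)
  then have "admits (e - 1) (add_mset z (add_mset ?c W))" by (simp add: add_mset_commute)
  then have "admits (e - 2) (add_mset (z @ ?c) W)" using admits_join[of "e - 1" z ?c W] by simp
  moreover have "eval (z @ ?c) = eval (z \<otimes>\<^bsub>F\<^esub> c)"
    using z xy l l' eval_word_inv_eq[OF l(2)] eval_word_inv_eq[OF l(3)]
    by (simp add: eval_append eval_carrier F.m_assoc)
  moreover have "z \<otimes>\<^bsub>F\<^esub> c \<in> carrier F" using z xy by simp
  ultimately show ?thesis by (metis admits_cong' carrier_F_letters)
qed

text \<open>The new factor word is free, a possible gain for trivial \<open>g\<close> being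
  discarded; only the join is paid for.\<close>

lemma admits_mult_factor:
  assumes adm: "admits e (add_mset z W)" and z: "z \<in> carrier F" and d: "conjugate_into_factor I G d"
  shows "admits (e - 1) (add_mset (z \<otimes>\<^bsub>F\<^esub> d) W)"
proof -
  obtain i g where i: "i \<in> I" "g \<in> carrier (G i)" and c: "conjugate F d (factor_embedding G i g)"
    using d by (auto simp: conjugate_into_factor_def)
  have d': "d \<in> carrier F" "factor_embedding G i g \<in> carrier F" using c by (auto simp: conjugate_def)
  have "admits (e + (if eval [(i, g)] = [] then 1 else 0)) (add_mset [(i, g)] (add_mset z W))"
    by (rule admits_add_factor_word[OF adm, of _ i]) (use i in auto)
  then have 1: "admits e (add_mset [(i, g)] (add_mset z W))" by (rule admits_mono) simp
  have "admits e (add_mset (factor_embedding G i g) (add_mset z W))"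
    using admits_eval[of e "[(i, g)]" "[]"] 1 by (simp add: eval_def factor_embedding_def)
  then have "admits e (add_mset d (add_mset z W))" using conjugate_sym[OF c] by (rule admits_conjugate)
  then have "admits e (add_mset z (add_mset d W))" by (simp add: add_mset_commute)
  then have "admits (e - 1) (add_mset (z @ d) W)" by (rule admits_join)
  moreover have "eval (z @ d) = eval (z \<otimes>\<^bsub>F\<^esub> d)" using z d' by (simp add: eval_mult eval_carrier)
  moreover have "z \<otimes>\<^bsub>F\<^esub> d \<in> carrier F" using z d' by simp
  ultimately show ?thesis by (metis admits_cong' carrier_F_letters)
qed

lemma conjugate_into_factor_carrier: "conjugate_into_factor I G d \<Longrightarrow> d \<in> carrier F"
  by (auto simp: conjugate_into_factor_def conjugate_def)

lemma is_commutator_carrier: "is_commutator F c \<Longrightarrow> c \<in> carrier F"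
  by (auto simp: is_commutator_def)

lemma foldr_mult_closed: "set xs \<subseteq> carrier F \<Longrightarrow> foldr (\<otimes>\<^bsub>F\<^esub>) xs [] \<in> carrier F"
  by (induction xs) (auto simp flip: one_F)

lemma foldr_mult_append:
  "set xs \<subseteq> carrier F \<Longrightarrow> set ys \<subseteq> carrier F \<Longrightarrow>
     foldr (\<otimes>\<^bsub>F\<^esub>) (xs @ ys) [] = foldr (\<otimes>\<^bsub>F\<^esub>) xs [] \<otimes>\<^bsub>F\<^esub> foldr (\<otimes>\<^bsub>F\<^esub>) ys []"
proof (induction xs)
  case Nil
  then show ?case using F.l_one[OF foldr_mult_closed, of ys] by simp
next
  case (Cons x xs)
  then show ?case using foldr_mult_closed[of xs] foldr_mult_closed[of ys] by (simp add: F.m_assoc)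
qed

text \<open>The empty product bounds a disk, which gives the 1.\<close>

lemma admits_product:
  assumes "\<forall>x\<in>set cs. is_commutator F x" "\<forall>x\<in>set ds. conjugate_into_factor I G x"
  shows "admits (1 - 2 * int (length cs) - int (length ds)) {#foldr (\<otimes>\<^bsub>F\<^esub>) (cs @ ds) []#}"
  using assms(2)
proof (induction ds rule: rev_induct)
  case Nil
  show ?case using assms(1)
  proof (induction cs rule: rev_induct)
    case Nil
    show ?case using admits_add_empty[OF admits_empty] by simp
  next
    case (snoc c cs)
    then have cs: "set cs \<subseteq> carrier F" "set [c] \<subseteq> carrier F" by (auto intro: is_commutator_carrier)
    have "foldr (\<otimes>\<^bsub>F\<^esub>) (cs @ [c]) [] = foldr (\<otimes>\<^bsub>F\<^esub>) cs [] \<otimes>\<^bsub>F\<^esub> c"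
      unfolding foldr_mult_append[OF cs] using cs F.r_one[of c] by simp
    then show ?case
      using snoc admits_mult_commutator[of "1 - 2 * int (length cs)" _ "{#}" c, OF _ foldr_mult_closed[OF cs(1)]]
      by (simp add: algebra_simps)
  qed
next
  case (snoc d ds)
  then have ds: "set (cs @ ds) \<subseteq> carrier F" "set [d] \<subseteq> carrier F"
    using assms(1) by (auto intro: is_commutator_carrier conjugate_into_factor_carrier)
  have "foldr (\<otimes>\<^bsub>F\<^esub>) ((cs @ ds) @ [d]) [] = foldr (\<otimes>\<^bsub>F\<^esub>) (cs @ ds) [] \<otimes>\<^bsub>F\<^esub> d"
    unfolding foldr_mult_append[OF ds] using ds F.r_one[of d] by simp
  then show ?case
    using snoc admits_mult_factor[of "1 - 2 * int (length cs) - int (length ds)" _ "{#}" d,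
        OF _ foldr_mult_closed[OF ds(1)]]
    by (simp add: algebra_simps del: foldr_append)
qed

text \<open>One split for each factor after the first.\<close>

lemma admits_factorize:
  assumes "admits e (add_mset (foldr (\<otimes>\<^bsub>F\<^esub>) (y # ys) []) W)" "set (y # ys) \<subseteq> carrier F"
  shows "admits (e - int (length ys)) (mset (y # ys) + W)"
  using assms
proof (induction ys arbitrary: y e W)
  case Nil
  then show ?case using F.r_one[of y] by simp
next
  case (Cons x ys)
  let ?r = "foldr (\<otimes>\<^bsub>F\<^esub>) (x # ys) []"
  have r: "?r \<in> carrier F" "y \<in> carrier F" using Cons.prems foldr_mult_closed[of "x # ys"] by auto
  have "eval (foldr (\<otimes>\<^bsub>F\<^esub>) (y # x # ys) []) = eval (y @ ?r)"
    using r eval_mult[OF r(2,1)] eval_carrier[of "y \<otimes>\<^bsub>F\<^esub> ?r"] by simp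
  moreover have "set (y @ ?r) \<subseteq> letters" using r carrier_F_letters by (metis Un_least set_append)
  ultimately have "admits e (add_mset (y @ ?r) W)" using admits_cong'[OF Cons.prems(1)] by blast
  then have "admits (e - 1) (add_mset y (add_mset ?r W))" by (rule admits_split)
  then have "admits (e - 1) (add_mset ?r (add_mset y W))" by (simp only: add_mset_commute)
  from Cons.IH[OF this] Cons.prems(2) show ?case by (simp add: algebra_simps add_mset_commute)
qed


section \<open>The bound for powers of a cyclically reduced word\<close>

lemma eval_replicate:
  assumes "i \<in> I" "g \<in> carrier (G i)"
  shows "eval (replicate k (i, g)) = factor_embedding G i (g [^]\<^bsub>G i\<^esub> k)"
proof (induction k)
  case 0
  then show ?case by (simp add: factor_embedding_def)
next
  case (Suc k)
  interpret group "G i" by (rule groups[OF assms(1)])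
  have "eval (replicate (Suc k) (i, g)) = letter_mult G (i, g) (letter_mult G (i, g [^]\<^bsub>G i\<^esub> k) [])"
    using Suc by (simp add: eval_Cons factor_embedding_def)
  also have "\<dots> = letter_mult G (i, g \<otimes>\<^bsub>G i\<^esub> g [^]\<^bsub>G i\<^esub> k) []"
    by (rule letter_mult_letter_mult[where I = I, OF groups]) (use assms in auto)
  also have "g \<otimes>\<^bsub>G i\<^esub> g [^]\<^bsub>G i\<^esub> k = g [^]\<^bsub>G i\<^esub> Suc k"
    using assms by (metis nat_pow_Suc2)
  finally show ?case by (simp only: factor_embedding_def)
qed

lemma eval_replicate_nontrivial:
  assumes "i \<in> I" "g \<in> carrier (G i)" "order_greater (G i) g N" "0 < k" "k \<le> N"
  shows "eval (replicate k (i, g)) \<noteq> []"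
proof
  interpret group "G i" by (rule groups[OF assms(1)])
  assume "eval (replicate k (i, g)) = []"
  then have "g [^]\<^bsub>G i\<^esub> k = \<one>\<^bsub>G i\<^esub>"
    using eval_replicate[OF assms(1,2)] by (simp add: factor_embedding_def split: if_splits)
  then have "ord g dvd k" using assms(2) by (simp add: pow_eq_id)
  then show False using assms(3-5) dvd_imp_le[of "ord g" k] by (auto simp: order_greater_def)
qed

text \<open>The last and first letters of \<open>w\<close> also meet in \<open>w @ w\<close>, which
  covers the index that wraps around.\<close>

lemma cyclically_reduced_adjacent:
  assumes "cyclically_reduced_word I G w" "i < length w"
  shows "fst (w ! (Suc i mod length w)) \<noteq> fst (w ! i)"
proof -
  have "successively (\<lambda>x y. fst x \<noteq> fst y) (w @ w)"
    using assms by (simp add: cyclically_reduced_word_def reduced_word_def)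
  then have "fst ((w @ w) ! i) \<noteq> fst ((w @ w) ! Suc i)"
    using assms(2) by (auto simp: successively_conv_nth)
  moreover have "(w @ w) ! Suc i = w ! (Suc i mod length w)"
    using assms(2) by (cases "Suc i = length w") (auto simp: nth_append)
  ultimately show ?thesis using assms(2) by (simp add: nth_append)
qed

lemma admits_powers_bound:
  assumes cyc: "cyclically_reduced_word I G w"
    and ord: "\<forall>(i, g)\<in>set w. order_greater (G i) g (sum_list ns)"
    and pos: "\<forall>k\<in>set ns. k > 0"
    and adm: "admits e (mset (map (\<lambda>k. concat (replicate k w)) ns))"
  shows "e \<le> - int (sum_list ns)"
proof -
  define N where "N = sum_list ns"
  define L where "L = length w"
  have w: "w \<noteq> []" "set w \<subseteq> letters"
    using cyc by (auto simp: cyclically_reduced_word_def reduced_word_def)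
  have L: "L > 0" using w by (simp add: L_def)
  \<comment> \<open>The positions in \<open>w\<close> of the successive letters of its
    \<open>k\<close>-th power.\<close>
  define y where "y = (\<lambda>k. map (\<lambda>t. t mod L) [0..<k * L])"
  obtain P :: "nat set" and lab s \<alpha> \<gamma> X A C where
    D: "diagram P lab s \<alpha> \<gamma> X A C" "mset (map (\<lambda>k. concat (replicate k w)) ns) = image_mset (map lab) X"
    "e \<le> euler P lab X A C"
    using adm unfolding admits_def by blast
  note d = D(1)[unfolded diagram_def]
  have s: "cycle_dec s P X" and \<alpha>: "cycle_dec \<alpha> P A" and \<gamma>: "cycle_dec \<gamma> P C" using d by auto
  have fin: "finite P" using s by (simp add: cycle_dec_def)
  have "map (nth w) (y k) = concat (replicate k w)" for k
    by (simp add: y_def concat_replicate_conv_upt L_def)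
  then have eq: "image_mset (map lab) X = image_mset (map (nth w)) (mset (map y ns))"
    using D(2) by (simp add: image_mset.compositionality comp_def flip: mset_map)
  \<comment> \<open>Each occurrence gets its position; different positions are kept apart even if
    they carry the same letter.\<close>
  obtain \<iota> where \<iota>: "image_mset (map \<iota>) X = mset (map y ns)" "\<And>p. p \<in> P \<Longrightarrow> w ! \<iota> p = lab p"
    "image_mset \<iota> (mset_set P) = (\<Sum>z\<in>#mset (map y ns). mset z)"
    using relabel_lift[OF _ fin eq] s by (auto simp: cycle_dec_def)
  have "set_mset (\<Sum>z\<in>#mset (map y ns). mset z) \<subseteq> {..<L}"
    using L by (auto simp: y_def)
  then have io_lt: "\<iota> p < L" if "p \<in> P" for p
    using that fin \<iota>(3) by (metis finite_set_mset_mset_set imageI lessThan_iff set_image_mset subsetD)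
  have fibre: "card {p \<in> P. \<iota> p = i} = N" if "i < L" for i
  proof -
    have "count (\<Sum>z\<in>#mset (map y ns). mset z) i = sum_list ns"
    proof (induction ns)
      case (Cons k ns)
      then show ?case using count_mod_upt[OF that, of k] by (simp add: y_def)
    qed simp
    then have "count (image_mset \<iota> (mset_set P)) i = N" using \<iota>(3) by (simp add: N_def)
    moreover have "count (image_mset \<iota> (mset_set P)) i = card {p \<in> P. \<iota> p = i}"
      using fin by (simp add: count_image_mset vimage_def Int_def conj_commute)
    ultimately show ?thesis by simp
  qed
  define \<sigma> where "\<sigma> = (\<lambda>i. Suc i mod L)"
  have step: "\<iota> (s p) = \<sigma> (\<iota> p)" if p: "p \<in> P" for p
  proof -
    obtain u v R where X: "X = add_mset (u @ p # v) R" using cycle_dec_pick[OF s p] .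
    let ?x = "u @ p # v"
    have "map \<iota> ?x \<in># mset (map y ns)" using \<iota>(1) X by (metis image_mset_add_mset union_single_eq_member)
    then obtain k where k: "map \<iota> ?x = y k" by auto
    have "map (\<lambda>p. \<iota> (s p)) ?x = map \<iota> (map s ?x)" by simp
    also have "\<dots> = map \<iota> (rotate1 ?x)" using cycle_dec_add(2)[OF s[unfolded X]] by simp
    also have "\<dots> = rotate1 (y k)" using k by (metis rotate1_map)
    also have "\<dots> = map \<sigma> (y k)" unfolding y_def \<sigma>_def by (rule map_Suc_mod_rotate1[symmetric])
    also have "\<dots> = map (\<lambda>p. \<sigma> (\<iota> p)) ?x" unfolding k[symmetric] by simp
    finally show ?thesis by simp
  qed
  have inj\<sigma>: "i = j" if "\<sigma> i = \<sigma> j" "i < L" "j < L" for i j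
    using that by (auto simp: \<sigma>_def mod_Suc split: if_splits)
  have comp: "\<alpha> (\<gamma> p) = s p" and gP: "\<gamma> p \<in> P" and aP: "\<alpha> p \<in> P" if "p \<in> P" for p
    using that d cycle_dec_in[OF \<gamma>] cycle_dec_in[OF \<alpha>] by auto
  \<comment> \<open>Disks over the factors will be charged to \<open>U\<close>, those over the base
    region to \<open>V\<close>, and the \<open>N\<close> points of \<open>Z\<close> stay
    uncharged.\<close>
  define U where "U = {p \<in> P. \<iota> p < \<iota> (\<alpha> p)}"
  define V where "V = {p \<in> P. \<iota> (\<alpha> p) < \<sigma> (\<iota> p)}"
  define Z where "Z = {p \<in> P. \<iota> p = L - 1}"
  have "size (disks lab A) \<le> card U"
    unfolding disks_def U_def
  proof (rule cycle_dec_count[OF \<alpha>])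
    fix x assume x: "x \<in># A" "eval (map lab x) = []"
    note c = cycle_decD[OF \<alpha> x(1)]
    have ne: "x \<noteq> []" using x(1) d by metis
    let ?i = "\<iota> (hd x)"
    \<comment> \<open>A cycle of constant position would spell a power of one letter with exponent
      at most \<open>N\<close>, since only \<open>N\<close> occurrences share a position; the order
      hypothesis makes that power nontrivial.\<close>
    have "\<exists>p\<in>set x. \<iota> (\<alpha> p) \<noteq> \<iota> p"
    proof (rule ccontr)
      assume "\<not> ?thesis"
      then have "map \<iota> (map \<alpha> x) = map \<iota> x" by simp
      then have "rotate1 (map \<iota> x) = map \<iota> x" using c(1) by (simp add: rotate1_map)
      then have const: "\<iota> p = ?i" if "p \<in> set x" for p
        using rotate1_fixed_constant[of "map \<iota> x" "\<iota> p"] that ne by (simp add: hd_map)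
      have i: "?i < L" using io_lt c(3) ne by (simp add: subset_iff)
      obtain j g where wi: "w ! ?i = (j, g)" by (cases "w ! ?i")
      have mem: "(j, g) \<in> set w" using i wi by (metis L_def nth_mem)
      have "map lab x = map (\<lambda>p. (j, g)) x"
        using const c(3) \<iota>(2) wi by (metis (no_types, lifting) map_eq_conv subsetD)
      then have lx: "map lab x = replicate (length x) (j, g)" by (simp add: map_replicate_const)
      have "set x \<subseteq> {p \<in> P. \<iota> p = ?i}" using const c(3) by auto
      then have "card (set x) \<le> card {p \<in> P. \<iota> p = ?i}"
        by (intro card_mono) (simp_all add: fin)
      then have "card (set x) \<le> N" unfolding fibre[OF i] .
      then have "length x \<le> sum_list ns" using distinct_card[OF c(2)] by (simp add: N_def)
      moreover have "order_greater (G j) g (sum_list ns)" using ord mem by auto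
      ultimately have "eval (replicate (length x) (j, g)) \<noteq> []"
        using w(2) mem ne by (intro eval_replicate_nontrivial) auto
      then show False using x(2) lx by simp
    qed
    then show "\<exists>p\<in>set x. \<iota> p < \<iota> (\<alpha> p)" using cycle_ascent[OF c(1,2)] by blast
  qed
  moreover have "size C \<le> card V"
  proof -
    \<comment> \<open>For \<open>q = \<gamma> p\<close> one has
      \<open>\<sigma> (\<iota> p) = \<iota> (s p) = \<iota> (\<alpha> q)\<close>, so an ascent from
      \<open>p\<close> to \<open>q\<close> says that \<open>q\<close> lies in
      \<open>V\<close>.\<close>
    have "size (filter_mset (\<lambda>_. True) C) \<le> card {p \<in> P. \<sigma> (\<iota> p) < \<sigma> (\<iota> (\<gamma> p))}"
    proof (rule cycle_dec_count[OF \<gamma>])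
      fix x assume x: "x \<in># C"
      note c = cycle_decD[OF \<gamma> x]
      have "x \<noteq> []" using x d by metis
      then obtain p where p: "p \<in> set x" by (cases x) auto
      then have pP: "p \<in> P" using c(3) by blast
      \<comment> \<open>Otherwise \<open>\<alpha>\<close> would connect two cyclically adjacent
        positions of \<open>w\<close> within one factor.\<close>
      have "\<iota> (\<gamma> p) \<noteq> \<iota> p"
      proof
        assume same: "\<iota> (\<gamma> p) = \<iota> p"
        have "fst (lab (s p)) = fst (lab (\<gamma> p))" using d comp[OF pP] gP[OF pP] by metis
        then have "fst (w ! \<sigma> (\<iota> p)) = fst (w ! \<iota> p)"
          using \<iota>(2)[OF cycle_dec_in[OF s pP]] \<iota>(2)[OF gP[OF pP]] step[OF pP] same by simp
        then show False
          using cyclically_reduced_adjacent[OF cyc, of "\<iota> p"] io_lt[OF pP] by (simp add: \<sigma>_def L_def)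
      qed
      then have "\<sigma> (\<iota> (\<gamma> p)) \<noteq> \<sigma> (\<iota> p)" using inj\<sigma> io_lt gP pP by blast
      then show "\<exists>p\<in>set x. \<sigma> (\<iota> p) < \<sigma> (\<iota> (\<gamma> p))"
        using cycle_ascent[OF c(1,2) p, of "\<lambda>p. \<sigma> (\<iota> p)"] by blast
    qed
    also have "\<dots> \<le> card V"
    proof (rule card_inj_on_le[of \<gamma>])
      show "inj_on \<gamma> {p \<in> P. \<sigma> (\<iota> p) < \<sigma> (\<iota> (\<gamma> p))}"
        using cycle_dec_bij(2)[OF \<gamma>] by (rule inj_on_subset) auto
      show "\<gamma> ` {p \<in> P. \<sigma> (\<iota> p) < \<sigma> (\<iota> (\<gamma> p))} \<subseteq> V"
        using comp gP step by (auto simp: V_def)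
    qed (use fin in \<open>simp add: V_def\<close>)
    finally show ?thesis by simp
  qed
  moreover have "card U + card V + N \<le> card P"
  proof -
    have lt: "\<sigma> i \<le> Suc i" for i by (simp add: \<sigma>_def)
    \<comment> \<open>Both ascents together would put an integer strictly between
      \<open>\<iota> p\<close> and \<open>\<iota> p + 1\<close>.\<close>
    have "\<not> (\<iota> p < \<iota> (\<alpha> p) \<and> \<iota> (\<alpha> p) < \<sigma> (\<iota> p))" for p using lt[of "\<iota> p"] by linarith
    then have UV: "U \<inter> V = {}" by (auto simp: U_def V_def)
    \<comment> \<open>At the last position \<open>\<iota>\<close> is already maximal and
      \<open>\<sigma>\<close> gives 0, so neither kind of ascent is possible.\<close>
    have "\<sigma> (L - 1) = 0" using L by (simp add: \<sigma>_def)
    then have Z: "(U \<union> V) \<inter> Z = {}"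
      using io_lt aP by (fastforce simp: U_def V_def Z_def)
    have sub: "finite U" "finite V" "finite Z" using fin by (auto simp: U_def V_def Z_def)
    have "card U + card V + card Z = card (U \<union> V \<union> Z)"
      using UV Z sub by (simp add: card_Un_disjoint)
    also have "\<dots> \<le> card P" by (rule card_mono[OF fin]) (auto simp: U_def V_def Z_def)
    finally show ?thesis using fibre[of "L - 1"] L by (simp add: Z_def)
  qed
  \<comment> \<open>Positive exponents exclude empty boundary words, so \<open>euler\<close>
    contains no caps.\<close>
  moreover have "[] \<notin># X"
  proof
    assume "[] \<in># X"
    then have "[] \<in># mset (map y ns)" by (metis \<iota>(1) image_eqI list.simps(8) set_image_mset)
    then show False using pos L by (auto simp: y_def)
  qed
  ultimately show ?thesis using D(3) by (simp add: euler_def N_def not_in_iff)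
qed


section \<open>Cyclic reduction\<close>

lemma conjugate_refl: "x \<in> carrier F \<Longrightarrow> conjugate F x x"
  unfolding conjugate_def using F.one_closed by (auto intro!: bexI[of _ "[]"] simp flip: one_F)

lemma conjugate_trans:
  assumes "conjugate F x y" "conjugate F y z"
  shows "conjugate F x z"
proof -
  obtain a b where *: "x \<in> carrier F" "a \<in> carrier F" "y = inv\<^bsub>F\<^esub> a \<otimes>\<^bsub>F\<^esub> x \<otimes>\<^bsub>F\<^esub> a"
    "z \<in> carrier F" "b \<in> carrier F" "z = inv\<^bsub>F\<^esub> b \<otimes>\<^bsub>F\<^esub> y \<otimes>\<^bsub>F\<^esub> b"
    using assms by (auto simp: conjugate_def)
  then have "z = inv\<^bsub>F\<^esub> (a \<otimes>\<^bsub>F\<^esub> b) \<otimes>\<^bsub>F\<^esub> x \<otimes>\<^bsub>F\<^esub> (a \<otimes>\<^bsub>F\<^esub> b)"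
    by (simp add: F.inv_mult_group F.m_assoc)
  then show ?thesis using * unfolding conjugate_def by blast
qed

lemma conjugate_pow:
  assumes "conjugate F x y"
  shows "conjugate F (x [^]\<^bsub>F\<^esub> (n::nat)) (y [^]\<^bsub>F\<^esub> n)"
proof -
  obtain g where g: "x \<in> carrier F" "y \<in> carrier F" "g \<in> carrier F"
    "y = inv\<^bsub>F\<^esub> g \<otimes>\<^bsub>F\<^esub> x \<otimes>\<^bsub>F\<^esub> g" using assms by (auto simp: conjugate_def)
  have "y [^]\<^bsub>F\<^esub> n = inv\<^bsub>F\<^esub> g \<otimes>\<^bsub>F\<^esub> x [^]\<^bsub>F\<^esub> n \<otimes>\<^bsub>F\<^esub> g"
  proof (induction n)
    case 0
    then show ?case using g by (simp flip: one_F)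
  next
    case (Suc n)
    have "g \<otimes>\<^bsub>F\<^esub> (inv\<^bsub>F\<^esub> g \<otimes>\<^bsub>F\<^esub> z) = z" if "z \<in> carrier F" for z
      using that g F.m_assoc[of g "inv\<^bsub>F\<^esub> g" z] by simp
    then show ?case using Suc g by (simp add: F.m_assoc)
  qed
  then show ?thesis using g unfolding conjugate_def by blast
qed

lemma length_mult_le:
  "length (foldr (letter_mult G) u v) \<le> length u + length v"
proof (induction u)
  case (Cons a u)
  have "length (letter_mult G a z) \<le> Suc (length z)" for z
    by (cases "(G, a, z)" rule: letter_mult.cases) auto
  from this[of "foldr (letter_mult G) u v"] show ?case using Cons by simp
qed simp

text \<open>While the first and last letters lie in one factor, conjugation by the first letter
  moves it to the end, where it merges with the last and the word gets shorter. Words of length at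
  most 1 lie in a factor and are excluded.\<close>

lemma exists_cyclically_reduced_conjugate:
  assumes "x \<in> carrier F" "\<not> conjugate_into_factor I G x" "I \<noteq> {}"
  shows "\<exists>w. cyclically_reduced_word I G w \<and> conjugate F w x"
  using assms(1,2)
proof (induction x rule: length_induct)
  case (1 x)
  obtain i where i: "i \<in> I" using assms(3) by blast
  have emb: "conjugate_into_factor I G x" if "x = factor_embedding G i g" "i \<in> I" "g \<in> carrier (G i)" for i g
    using that conjugate_refl[OF 1(2)] by (auto simp: conjugate_into_factor_def)
  interpret Gi: group "G i" by (rule groups[OF i])
  have "x \<noteq> []" using emb[of i "\<one>\<^bsub>G i\<^esub>"] i 1(3) by (auto simp: factor_embedding_def)
  then obtain a z where x: "x = a # z" by (cases x) auto
  have red: "reduced_word I G x" using 1(2) \<open>x \<noteq> []\<close> by (simp add: carrier_F)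
  have "z \<noteq> []"
  proof
    assume "z = []"
    then show False using emb[of "fst a" "snd a"] red 1(3)
      by (auto simp: x reduced_word_def factor_embedding_def)
  qed
  then obtain y b where z: "z = y @ [b]" by (cases z rule: rev_cases) auto
  show ?case
  proof (cases "fst a = fst b")
    case False
    then have "fst (last x) \<noteq> fst (hd x)" by (simp add: x z)
    then have "cyclically_reduced_word I G x"
      using red by (auto simp: cyclically_reduced_word_def reduced_word_def successively_append_iff)
    then show ?thesis using conjugate_refl[OF 1(2)] by blast
  next
    case True
    have az: "[a] \<in> carrier F" "z \<in> carrier F"
      using red by (auto simp: carrier_F reduced_word_def x z successively_Cons)
    have "x = [a] \<otimes>\<^bsub>F\<^esub> z"
      using red by (cases z; cases a) (auto simp: x mult_F reduced_word_def)
    then have xa: "inv\<^bsub>F\<^esub> [a] \<otimes>\<^bsub>F\<^esub> x \<otimes>\<^bsub>F\<^esub> [a] = z \<otimes>\<^bsub>F\<^esub> [a]"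
      using az F.m_assoc[of "inv\<^bsub>F\<^esub> [a]" "[a]" z] by simp
    define x' where "x' = z \<otimes>\<^bsub>F\<^esub> [a]"
    have c: "conjugate F x x'"
      using az 1(2) xa[symmetric] unfolding conjugate_def x'_def by auto
    have "x' = foldr (letter_mult G) y (letter_mult G b [a])" by (simp add: x'_def mult_F z)
    moreover have "length (letter_mult G b [a]) \<le> 1" using True by (cases a; cases b) auto
    ultimately have "length x' \<le> length y + 1" using length_mult_le[of y "letter_mult G b [a]"] by simp
    then have len: "length x' < length x" by (simp add: x z)
    have "\<not> conjugate_into_factor I G x'"
      using 1(3) conjugate_trans[OF c] by (auto simp: conjugate_into_factor_def)
    moreover have "x' \<in> carrier F" using c by (simp add: conjugate_def)
    ultimately obtain w where "cyclically_reduced_word I G w" "conjugate F w x'"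
      using 1(1) len by blast
    then show ?thesis using conjugate_trans conjugate_sym[OF c] by blast
  qed
qed

lemma eval_power: "w \<in> carrier F \<Longrightarrow> eval (concat (replicate n w)) = w [^]\<^bsub>F\<^esub> n"
proof (induction n)
  case (Suc n)
  have "set (concat (replicate n w)) \<subseteq> letters" using carrier_F_letters[OF Suc.prems] by auto
  then have "eval (concat (replicate (Suc n) w)) = w \<otimes>\<^bsub>F\<^esub> w [^]\<^bsub>F\<^esub> n"
    using Suc carrier_F_letters[OF Suc.prems] by (simp add: eval_append eval_carrier)
  then show ?case using F.nat_pow_Suc2[OF Suc.prems] by metis
qed simp

lemma admits_map:
  assumes "admits e (mset (map f js) + W)"
    and "\<And>j W. j \<in> set js \<Longrightarrow> admits e (add_mset (f j) W) \<Longrightarrow> admits e (add_mset (f' j) W)"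
  shows "admits e (mset (map f' js) + W)"
  using assms
proof (induction js arbitrary: W)
  case (Cons j js)
  have "admits e (add_mset (f' j) (mset (map f js) + W))"
    using Cons.prems(1) by (intro Cons.prems(2)) auto
  then have "admits e (mset (map f js) + add_mset (f' j) W)" by simp
  then have "admits e (mset (map f' js) + add_mset (f' j) W)"
    by (rule Cons.IH) (rule Cons.prems(2); simp)
  then show ?case by simp
qed simp

text \<open>With \<open>k\<close>, \<open>l\<close>, \<open>m\<close> the lengths of the three
  lists, the product admits \<open>1 - 2k - l\<close>. Separating the powers costs
  \<open>m - 1\<close>, and replacing each by the same power of \<open>w\<close> costs nothing; the
  count of disks bounds what remains by minus the sum of the exponents.\<close>

theorem powers_of_conjugates_bound:
  fixes h :: "nat \<Rightarrow> ('i \<times> 'a) list" and n :: "nat \<Rightarrow> nat"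
  assumes cs: "\<forall>x\<in>set cs. is_commutator F x"
    and ds: "\<forall>x\<in>set ds. conjugate_into_factor I G x"
    and js: "js \<noteq> []"
    and w: "cyclically_reduced_word I G w" "\<And>j. j \<in> set js \<Longrightarrow> conjugate F w (h j)"
    and ord: "\<forall>(i, g)\<in>set w. order_greater (G i) g (\<Sum>j\<leftarrow>js. n j)"
    and pos: "\<And>j. j \<in> set js \<Longrightarrow> n j > 0"
    and eq: "foldr (\<otimes>\<^bsub>F\<^esub>) (cs @ ds) [] = foldr (\<otimes>\<^bsub>F\<^esub>) (map (\<lambda>j. h j [^]\<^bsub>F\<^esub> n j) js) []"
  shows "int (\<Sum>j\<leftarrow>js. n j) \<le> 2 * int (length cs) + int (length ds) + int (length js) - 2"
proof -
  let ?h = "\<lambda>j. h j [^]\<^bsub>F\<^esub> n j" and ?w = "\<lambda>j. concat (replicate (n j) w)"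
  have wF: "w \<in> carrier F" using w(2)[OF hd_in_set[OF js]] by (simp add: conjugate_def)
  obtain j0 js' where js0: "js = j0 # js'" using js by (cases js) auto
  have hF: "h j \<in> carrier F" if "j \<in> set js" for j using w(2)[OF that] by (simp add: conjugate_def)
  let ?e = "1 - 2 * int (length cs) - int (length ds)"
  have "admits ?e (add_mset (foldr (\<otimes>\<^bsub>F\<^esub>) (?h j0 # map ?h js') []) {#})"
    using admits_product[OF cs ds] eq by (simp only: js0 list.map)
  then have "admits (?e - int (length (map ?h js'))) (mset (?h j0 # map ?h js') + {#})"
    by (rule admits_factorize) (use hF js0 in auto)
  then have "admits (?e - int (length js')) (mset (map ?h js) + {#})" by (simp add: js0)
  then have "admits (?e - int (length js')) (mset (map ?w js) + {#})"
  proof (rule admits_map)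
    fix j W assume j: "j \<in> set js" and adm: "admits (?e - int (length js')) (add_mset (?h j) W)"
    have c: "conjugate F (?h j) (w [^]\<^bsub>F\<^esub> n j)"
      using conjugate_sym[OF conjugate_pow[OF w(2)[OF j]]] .
    have "set (?w j) \<subseteq> letters" using carrier_F_letters[OF wF] by auto
    then show "admits (?e - int (length js')) (add_mset (?w j) W)"
      using admits_cong'[OF admits_conjugate[OF adm c]] wF by (simp add: eval_power eval_carrier)
  qed
  then have "admits (?e - int (length js')) (mset (map (\<lambda>k. concat (replicate k w)) (map n js)))"
    by (simp add: comp_def)
  then have "?e - int (length js') \<le> - int (sum_list (map n js))"
    by (intro admits_powers_bound[OF w(1)]) (use ord pos in auto)
  then show ?thesis by (simp add: js0)
qed

end

section \<open>Both inequalities from the bound for lists\<close>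

theorem mainTheorem1:
  fixes I :: "'i set"
    and G :: "'i \<Rightarrow> ('a, 'b) monoid_scheme"
    and F :: "('i \<times> 'a) list monoid"
    and k l m :: nat
    and c d h :: "nat \<Rightarrow> ('i \<times> 'a) list"
    and n :: "nat \<Rightarrow> nat"
  defines "F \<equiv> free_product I G"
  assumes "I \<noteq> {}"
    and "\<And>i. i \<in> I \<Longrightarrow> group (G i)"
    and "m \<ge> 1"
    and "\<And>j. j \<in> {1..k} \<Longrightarrow> is_commutator F (c j)"
    and "\<And>j. j \<in> {1..l} \<Longrightarrow> conjugate_into_factor I G (d j)"
    and "\<And>j. j \<in> {1..m} \<Longrightarrow> h j \<in> carrier F"
    and "\<And>j j'. j \<in> {1..m} \<Longrightarrow> j' \<in> {1..m} \<Longrightarrow> conjugate F (h j) (h j')"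
    and "\<And>j. j \<in> {1..m} \<Longrightarrow> \<not> conjugate_into_factor I G (h j)"
    and "\<And>j. j \<in> {1..m} \<Longrightarrow> n j > 0"
    and "foldr (\<otimes>\<^bsub>F\<^esub>) (map c [1..<Suc k] @ map d [1..<Suc l]) \<one>\<^bsub>F\<^esub> =
         foldr (\<otimes>\<^bsub>F\<^esub>) (map (\<lambda>j. h j [^]\<^bsub>F\<^esub> n j) [1..<Suc m]) \<one>\<^bsub>F\<^esub>"
  shows "((\<forall>i\<in>I. torsion_free (G i)) \<longrightarrow>
            (\<Sum>j = 1..m. (int (n j) - 1)) \<le> 2 * int k + int l - 2) \<and>
         ((\<exists>w. cyclically_reduced_word I G w \<and> conjugate F w (h 1) \<and>
               (\<forall>(i, g) \<in> set w. order_greater (G i) g (\<Sum>j = 1..m. n j))) \<longrightarrow>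
            (\<Sum>j = 1..m. (int (n j) - 1)) \<le> 2 * int k + int l - 2)"
proof -
  interpret group_family I G by (rule group_family.intro) fact
  have 1: "1 \<in> {1..m}" using \<open>m \<ge> 1\<close> by simp
  have set_upt: "set [1..<Suc r] = {1..r}" for r by auto
  have sum: "(\<Sum>j\<leftarrow>[1..<Suc m]. n j) = (\<Sum>j = 1..m. n j)"
    by (simp only: sum_list_distinct_conv_sum_set distinct_upt set_upt)
  have part2: "(\<Sum>j = 1..m. (int (n j) - 1)) \<le> 2 * int k + int l - 2"
    if w: "cyclically_reduced_word I G w" "conjugate F w (h 1)"
      "\<forall>(i, g)\<in>set w. order_greater (G i) g (\<Sum>j = 1..m. n j)" for w
  proof -
    have "int (\<Sum>j\<leftarrow>[1..<Suc m]. n j) \<le> 2 * int (length (map c [1..<Suc k])) +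
        int (length (map d [1..<Suc l])) + int (length [1..<Suc m]) - 2"
    proof (rule powers_of_conjugates_bound[of _ _ _ w h])
      show "\<forall>x\<in>set (map c [1..<Suc k]). is_commutator (free_product I G) x"
        "\<forall>x\<in>set (map d [1..<Suc l]). conjugate_into_factor I G x"
        using assms(5,6) unfolding set_map set_upt F_def by auto
      show "conjugate (free_product I G) w (h j)" if "j \<in> set [1..<Suc m]" for j
        using conjugate_trans[of w "h 1" "h j"] w(2) assms(8)[OF 1, of j] that
        unfolding set_upt F_def by blast
      show "n j > 0" if "j \<in> set [1..<Suc m]" for j using assms(10) that unfolding set_upt .
      show "foldr (\<otimes>\<^bsub>free_product I G\<^esub>) (map c [1..<Suc k] @ map d [1..<Suc l]) [] =
          foldr (\<otimes>\<^bsub>free_product I G\<^esub>) (map (\<lambda>j. h j [^]\<^bsub>free_product I G\<^esub> n j) [1..<Suc m]) []"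
        using assms(11) unfolding F_def one_F .
    qed (use w(1,3) sum \<open>m \<ge> 1\<close> in \<open>simp_all del: upt_Suc\<close>)
    \<comment> \<open>Subtracting \<open>m\<close> from both sides turns the sum of the exponents
      into the sum of \<open>n j - 1\<close>.\<close>
    then show ?thesis unfolding sum by (simp add: sum_subtractf del: upt_Suc)
  qed
  \<comment> \<open>Without torsion all letters of a cyclically reduced word, being nontrivial, have
    infinite order. So (1) follows from (2) once such a word exists, which is where non-conjugacy
    into factors enters.\<close>
  have part1: "\<exists>w. cyclically_reduced_word I G w \<and> conjugate F w (h 1) \<and>
      (\<forall>(i, g) \<in> set w. order_greater (G i) g (\<Sum>j = 1..m. n j))"
    if tf: "\<forall>i\<in>I. torsion_free (G i)"
  proof -
    obtain w where w: "cyclically_reduced_word I G w" "conjugate F w (h 1)"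
      using exists_cyclically_reduced_conjugate[of "h 1"] assms(7,9)[OF 1] \<open>I \<noteq> {}\<close>
      unfolding F_def by blast
    have "\<forall>(i, g) \<in> set w. order_greater (G i) g N" for N
      using w(1) tf
      by (auto simp: cyclically_reduced_word_def reduced_word_def torsion_free_def order_greater_def)
    then show ?thesis using w by blast
  qed
  show ?thesis using part1 part2 by blast
qed

end
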